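(* If $(T,f)$ is a Hubbard tree with $\star$-periodic or preperiodic kneading sequence $\nu$, then $\nu$ alone determines $(T,f)$ uniquely up to equivalence; that is, any two Hubbard trees with the same kneading sequence $\nu$ are equivalent.
   Context: Trees. A tree $T$ is a finite connected (topological) graph without loops. The arms of $x\in T$ are the connected components of $T\setminus\{x\}$. The point $x$ is an endpoint if it has only one arm, a branch point if it has at least three arms. For $x,y\in T$, $[x,y]$ is the unique closed arc connecting them. Hubbard trees. A Hubbard tree is a tree $T$ with a map $f\colon T\to T$ and a distinguished point, the critical point, such that: (1) $f$ is continuous and surjective; (2) every point has at most two inverse images under $f$; (3) at every point other than the critical point, $f$ is a local homeomorphism onto its image; (4) all endpoints of $T$ are on the critical orbit; (5) the critical point is periodic or preperiodic, but not fixed; (6) (expansivity) if $x\neq y$ are branch points or points on the critical orbit, then there is $n\ge 0$ such that $f^{\circ n}([x,y])$ contains the critical point. Write $c_0=0$ for the critical point, $c_k=f^{\circ k}(0)$; $c_1$ is the critical value and $c_1\neq c_0$. The marked points are the branch points and the points $c_k$, $k\ge 0$. Equivalence. Two Hubbard trees $(T,f)$ and $(T',f')$ are equivalent if there is a bijection between their marked points which is respected by the dynamics, and if the edges of the trees connect the same (corresponding) marked points. Kneading sequence. Let $T_{\mathtt 1}$ be the component of $T\setminus\{0\}$ containing $c_1$, $T_\star=\{0\}$, $T_{\mathtt 0}=T\setminus(T_{\mathtt 1}\cup\{0\})$ (possibly empty). The itinerary of $x\in T$ is the sequence $e_1e_2e_3\dots$ over $\{\mathtt 0,\star,\mathtt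 1\}$ with $f^{\circ(j-1)}(x)\in T_{e_j}$. The kneading sequence of $(T,f)$ is the itinerary of $c_1$; it starts with $\mathtt 1$. If $0$ is periodic of period $n$, it has the form $\overline{\mathtt 1\nu_2\dots\nu_{n-1}\star}$ with $\nu_i\in\{\mathtt 0,\mathtt 1\}$; such sequences are called $\star$-periodic. *)

theory Defs
  imports "HOL-Analysis.Analysis"
begin

text \<open>
  Trees are subsets of an arbitrary Hausdorff space. An \<open>arc\<close> is then a homeomorphism from
  \<open>[0,1]\<close> onto its image, and a finite union of arcs automatically carries the topology of a finite
  graph. Closed edges need not be allowed, since they can be subdivided (and do not occur in trees).
\<close>

definition finite_topological_graph :: "'a::t2_space set \<Rightarrow> 'a set \<Rightarrow> 'a set set \<Rightarrow> bool" where
  "finite_topological_graph T V E \<longleftrightarrow>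
     finite V \<and> finite E \<and> T = V \<union> \<Union>E \<and>
     (\<forall>e\<in>E. \<exists>g. arc g \<and> path_image g = e \<and> e \<inter> V = {pathstart g, pathfinish g}) \<and>
     (\<forall>e\<in>E. \<forall>e'\<in>E. e \<noteq> e' \<longrightarrow> e \<inter> e' \<subseteq> V)"

text \<open>``Without loops'' means that \<open>T\<close> contains no simple closed curve.\<close>

definition tree :: "'a::t2_space set \<Rightarrow> bool" where
  "tree T \<longleftrightarrow>
     T \<noteq> {} \<and> connected T \<and> (\<exists>V E. finite_topological_graph T V E) \<and>
     \<not> (\<exists>g. simple_path g \<and> pathfinish g = pathstart g \<and> path_image g \<subseteq> T)"

definition arms :: "'a::t2_space set \<Rightarrow> 'a \<Rightarrow> 'a set set" where
  "arms T x = components (T - {x})"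

definition endpoints :: "'a::t2_space set \<Rightarrow> 'a set" where
  "endpoints T = {x \<in> T. card (arms T x) = 1}"

text \<open>A point of a tree has finitely many arms, so \<open>card\<close> is the true number of arms.\<close>

definition branch_points :: "'a::t2_space set \<Rightarrow> 'a set" where
  "branch_points T = {x \<in> T. 3 \<le> card (arms T x)}"

text \<open>The closed arc \<open>[x,y]\<close>; it degenerates to a point if \<open>x = y\<close>.\<close>

definition tree_arc :: "'a::t2_space set \<Rightarrow> 'a \<Rightarrow> 'a \<Rightarrow> 'a set" where
  "tree_arc T x y =
     (if x = y then {x}
      else (THE A. A \<subseteq> T \<and> (\<exists>g. arc g \<and> path_image g = A \<and> pathstart g = x \<and> pathfinish g = y)))"

definition critical_orbit :: "('a \<Rightarrow> 'a) \<Rightarrow> 'a \<Rightarrow> 'a set" where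
  "critical_orbit f c = {(f ^^ k) c | k. True}"

definition marked_points :: "'a::t2_space set \<Rightarrow> ('a \<Rightarrow> 'a) \<Rightarrow> 'a \<Rightarrow> 'a set" where
  "marked_points T f c = branch_points T \<union> critical_orbit f c"

definition periodic_point :: "('a \<Rightarrow> 'a) \<Rightarrow> 'a \<Rightarrow> bool" where
  "periodic_point f x \<longleftrightarrow> (\<exists>p>0. (f ^^ p) x = x)"

definition preperiodic_point :: "('a \<Rightarrow> 'a) \<Rightarrow> 'a \<Rightarrow> bool" where
  "preperiodic_point f x \<longleftrightarrow> \<not> periodic_point f x \<and> (\<exists>k. periodic_point f ((f ^^ k) x))"

text \<open>
  \<open>f\<close> is a total function of which only the restriction to \<open>T\<close> matters. A local homeomorphism
  onto its image is homeomorphic from some neighbourhood \<open>U\<close> of the point in \<open>T\<close> onto \<open>f ` U\<close> with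
  its subspace topology; \<open>f ` U\<close> is not required to be open in \<open>T\<close> (it need not be at an endpoint).
\<close>

definition hubbard_tree :: "'a::t2_space set \<Rightarrow> ('a \<Rightarrow> 'a) \<Rightarrow> 'a \<Rightarrow> bool" where
  "hubbard_tree T f c \<longleftrightarrow>
     tree T \<and> c \<in> T \<and>
     continuous_on T f \<and> f ` T = T \<and>
     (\<forall>y\<in>T. finite {x \<in> T. f x = y} \<and> card {x \<in> T. f x = y} \<le> 2) \<and>
     (\<forall>x\<in>T - {c}. \<exists>U g. openin (top_of_set T) U \<and> x \<in> U \<and> homeomorphism U (f ` U) f g) \<and>
     endpoints T \<subseteq> critical_orbit f c \<and>
     (periodic_point f c \<or> preperiodic_point f c) \<and> f c \<noteq> c \<and>
     (\<forall>x\<in>marked_points T f c. \<forall>y\<in>marked_points T f c.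
        x \<noteq> y \<longrightarrow> (\<exists>n. c \<in> (f ^^ n) ` tree_arc T x y))"

text \<open>
  The edges of a Hubbard tree are the closed arcs joining two distinct marked points and containing
  no further marked point.
\<close>

definition joined_by_edge :: "'a::t2_space set \<Rightarrow> ('a \<Rightarrow> 'a) \<Rightarrow> 'a \<Rightarrow> 'a \<Rightarrow> 'a \<Rightarrow> bool" where
  "joined_by_edge T f c x y \<longleftrightarrow> x \<noteq> y \<and> tree_arc T x y \<inter> marked_points T f c = {x, y}"

definition hubbard_equivalent ::
  "'a::t2_space set \<Rightarrow> ('a \<Rightarrow> 'a) \<Rightarrow> 'a \<Rightarrow> 'b::t2_space set \<Rightarrow> ('b \<Rightarrow> 'b) \<Rightarrow> 'b \<Rightarrow> bool" where
  "hubbard_equivalent T f c T' f' c' \<longleftrightarrow>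
     (\<exists>\<phi>. bij_betw \<phi> (marked_points T f c) (marked_points T' f' c') \<and>
          (\<forall>x\<in>marked_points T f c. \<phi> (f x) = f' (\<phi> x)) \<and>
          (\<forall>x\<in>marked_points T f c. \<forall>y\<in>marked_points T f c.
             joined_by_edge T f c x y \<longleftrightarrow> joined_by_edge T' f' c' (\<phi> x) (\<phi> y)))"

datatype symbol = Zero | Star | One

definition symbol_of :: "'a::t2_space set \<Rightarrow> ('a \<Rightarrow> 'a) \<Rightarrow> 'a \<Rightarrow> 'a \<Rightarrow> symbol" where
  "symbol_of T f c x =
     (if x = c then Star
      else if x \<in> connected_component_set (T - {c}) (f c) then One
      else Zero)"

text \<open>Sequences \<open>e\<^sub>1 e\<^sub>2 e\<^sub>3 \<dots>\<close> are indexed from 0 here: \<open>e i\<close> stands for \<open>e\<^sub>i\<^sub>+\<^sub>1\<close>.\<close>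

definition itinerary :: "'a::t2_space set \<Rightarrow> ('a \<Rightarrow> 'a) \<Rightarrow> 'a \<Rightarrow> 'a \<Rightarrow> nat \<Rightarrow> symbol" where
  "itinerary T f c x = (\<lambda>i. symbol_of T f c ((f ^^ i) x))"

definition kneading_sequence :: "'a::t2_space set \<Rightarrow> ('a \<Rightarrow> 'a) \<Rightarrow> 'a \<Rightarrow> nat \<Rightarrow> symbol" where
  "kneading_sequence T f c = itinerary T f c (f c)"

definition star_periodic :: "(nat \<Rightarrow> symbol) \<Rightarrow> bool" where
  "star_periodic \<nu> \<longleftrightarrow>
     (\<exists>n\<ge>2. \<nu> 0 = One \<and> (\<forall>i<n - 1. \<nu> i \<in> {Zero, One}) \<and> \<nu> (n - 1) = Star \<and>
            (\<forall>i. \<nu> (i + n) = \<nu> i))"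

definition periodic_seq :: "(nat \<Rightarrow> 'b) \<Rightarrow> bool" where
  "periodic_seq s \<longleftrightarrow> (\<exists>p>0. \<forall>i. s (i + p) = s i)"

definition preperiodic_seq :: "(nat \<Rightarrow> 'b) \<Rightarrow> bool" where
  "preperiodic_seq s \<longleftrightarrow> \<not> periodic_seq s \<and> (\<exists>k. periodic_seq (\<lambda>i. s (i + k)))"

end

theory Submission imports Defs
begin

text \<open>
  Marked points are determined by their itineraries: by induction, as long as the symbols of two
  marked points agree, \<open>f\<close> maps the arc between them injectively and this arc avoids the critical
  point, so expansivity makes the itineraries of distinct marked points different.

  Every branch point is the median of three endpoints, hence of three points of the critical orbit,
  and the itinerary of a median is computed from the itineraries of the three points and \<open>\<nu>\<close>: two
  of the points typically lie in the same arm of \<open>c\<close> (there are at most two arms, as \<open>f c\<close> is an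
  endpoint), the median lies in that arm, and \<open>f\<close> carries it to the median of the images, where the
  third point is replaced by \<open>c\<close> if it lies outside that arm. In all other cases the median is \<open>c\<close>.
  So matching itineraries gives a bijection between the marked points of the two trees that respects
  the dynamics and medians. As \<open>z \<in> [x,y]\<close> iff \<open>z\<close> is the median of \<open>x, y, z\<close>, it respects edges.
\<close>

section \<open>Arcs in Hausdorff spaces\<close>

text \<open>
  The degenerate case \<open>A = {x}\<close>, \<open>x = y\<close> is included, so that computations with the
  arcs \<open>[x,y]\<close> need no case distinctions.
\<close>

definition arc_between :: "'a::t2_space set \<Rightarrow> 'a \<Rightarrow> 'a \<Rightarrow> bool" where
  "arc_between A x y \<longleftrightarrow>
     (\<exists>a b g. (a::real) \<le> b \<and> continuous_on {a..b} g \<and> inj_on g {a..b} \<and>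
              g a = x \<and> g b = y \<and> g ` {a..b} = A)"

lemma arc_betweenI:
  assumes "(a::real) \<le> b" "continuous_on {a..b} g" "inj_on g {a..b}"
  shows "arc_between (g ` {a..b}) (g a) (g b)"
  unfolding arc_between_def using assms by blast

lemma arc_between_restrict:
  assumes "continuous_on {a..b} g" "inj_on g {a..b}" "(a::real) \<le> s" "s \<le> t" "t \<le> b"
  shows "arc_between (g ` {s..t}) (g s) (g t)"
proof (rule arc_betweenI[OF assms(4)])
  have "{s..t} \<subseteq> {a..b}" using assms by auto
  then show "continuous_on {s..t} g" "inj_on g {s..t}"
    using assms(1,2) continuous_on_subset inj_on_subset by metis+
qed

lemma arc_between_refl: "arc_between {x} x x"
  using arc_betweenI[of 0 0 "\<lambda>_. x"] by simp

lemma arc_between_same: "arc_between A x x \<Longrightarrow> A = {x}"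
proof -
  assume "arc_between A x x"
  then obtain a b :: real and g where g: "a \<le> b" "inj_on g {a..b}" "g a = x" "g b = x" "g ` {a..b} = A"
    unfolding arc_between_def by blast
  then have "a = b"
    by (metis atLeastAtMost_iff inj_onD order_refl)
  with g show ?thesis by auto
qed

lemma arc_between_sym:
  assumes "arc_between A x y" shows "arc_between A y x"
proof -
  obtain a b :: real and g where g: "a \<le> b" "continuous_on {a..b} g" "inj_on g {a..b}"
    "g a = x" "g b = y" "g ` {a..b} = A"
    using assms unfolding arc_between_def by blast
  have "continuous_on {-b..-a} (\<lambda>t. g (- t))"
    by (rule continuous_on_compose2[OF g(2)]) (auto intro!: continuous_intros)
  moreover have "inj_on (\<lambda>t. g (- t)) {-b..-a}"
    by (rule inj_onI) (use g(3) in \<open>auto dest!: inj_onD\<close>)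
  moreover have "(\<lambda>t. g (- t)) ` {-b..-a} = A"
    unfolding g(6)[symmetric] image_image[of g uminus, symmetric] by simp
  ultimately show ?thesis using arc_betweenI[of "-b" "-a" "\<lambda>t. g (- t)"] g by simp
qed

lemma arc_between_ends: "arc_between A x y \<Longrightarrow> x \<in> A \<and> y \<in> A"
  unfolding arc_between_def by (metis atLeastAtMost_iff image_eqI order_refl)

lemma arc_between_compact: "arc_between A x y \<Longrightarrow> compact A"
  unfolding arc_between_def by (metis compact_Icc compact_continuous_image)

lemma arc_between_closed: "arc_between A x y \<Longrightarrow> closed A"
  by (simp add: arc_between_compact compact_imp_closed)

lemma arc_between_connected: "arc_between A x y \<Longrightarrow> connected A"
  unfolding arc_between_def by (metis connected_Icc connected_continuous_image)

lemma arc_between_split: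
  assumes "arc_between A x y" "z \<in> A"
  obtains B C where "arc_between B x z" "arc_between C z y" "A = B \<union> C" "B \<inter> C = {z}"
proof -
  obtain a b :: real and g where g: "a \<le> b" "continuous_on {a..b} g" "inj_on g {a..b}"
    "g a = x" "g b = y" "g ` {a..b} = A"
    using assms unfolding arc_between_def by blast
  obtain t where t: "a \<le> t" "t \<le> b" "g t = z" using assms(2) g(6) by auto
  have "arc_between (g ` {a..t}) x z"
    using arc_between_restrict[OF g(2,3), of a t] g(4) t by simp
  moreover have "arc_between (g ` {t..b}) z y"
    using arc_between_restrict[OF g(2,3), of t b] g(5) t by simp
  moreover have "A = g ` {a..t} \<union> g ` {t..b}"
    using g(6) t by (metis image_Un ivl_disj_un_two_touch(4))
  moreover have "g ` {a..t} \<inter> g ` {t..b} = g ` ({a..t} \<inter> {t..b})"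
    using t by (intro inj_on_image_Int[symmetric, OF g(3)]) auto
  moreover have "{a..t} \<inter> {t..b} = {t}" using t by auto
  ultimately show ?thesis using that t(3) by (metis image_empty image_insert)
qed

lemma arc_between_join:
  assumes "arc_between B x z" "arc_between C z y" "B \<inter> C = {z}"
  shows "arc_between (B \<union> C) x y"
proof -
  obtain a b :: real and g where g: "a \<le> b" "continuous_on {a..b} g" "inj_on g {a..b}"
    "g a = x" "g b = z" "g ` {a..b} = B"
    using assms(1) unfolding arc_between_def by blast
  obtain k d :: real and h where h: "k \<le> d" "continuous_on {k..d} h" "inj_on h {k..d}"
    "h k = z" "h d = y" "h ` {k..d} = C"
    using assms(2) unfolding arc_between_def by blast
  define e where "e = b + (d - k)"
  define h' where "h' t = h (t - b + k)" for t
  define G where "G t = (if t \<le> b then g t else h' t)" for t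
  have be: "b \<le> e" using h(1) by (simp add: e_def)
  have ch': "continuous_on {b..e} h'"
    unfolding h'_def by (rule continuous_on_compose2[OF h(2)]) (auto intro!: continuous_intros simp: e_def)
  have ih': "inj_on h' {b..e}"
    using h(3) unfolding h'_def inj_on_def e_def by (smt (verit) atLeastAtMost_iff)
  have h'b: "h' b = z" "h' e = y" using h by (auto simp: h'_def e_def)
  have imh': "h' ` {b..e} = C"
  proof -
    have "{k..d} = (\<lambda>t. t - b + k) ` {b..e}"
      by (auto simp: e_def image_iff intro!: bexI[where x="_ + b - k"])
    then show ?thesis unfolding h'_def h(6)[symmetric] by auto
  qed
  have "continuous_on ({a..b} \<union> {b..e}) G"
    unfolding G_def using g(2) ch' g(5) h'b be
    by (intro continuous_on_If) (auto intro: continuous_on_subset)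
  moreover have abe: "{a..b} \<union> {b..e} = {a..e}" using g(1) be by auto
  ultimately have 1: "continuous_on {a..e} G" by simp
  have Gg: "G t = g t" if "t \<in> {a..b}" for t using that by (simp add: G_def)
  have Gh: "G t = h' t" if "t \<in> {b..e}" for t using that g(5) h'b by (cases "t = b") (auto simp: G_def)
  \<comment> \<open>A value shared by both halves lies in \<open>B \<inter> C\<close>, hence is
    \<open>z\<close>, which \<open>h'\<close> takes only at \<open>b\<close>; the half-open interval
    excludes that parameter.\<close>
  have cross: False if "s \<in> {a..b}" "t \<in> {b<..e}" "g s = h' t" for s t
  proof -
    have "g s \<in> B" "h' t \<in> C" using that(1,2) g(6) imh' by auto
    then have "g s \<in> B \<inter> C" using that(3) by auto
    then have "h' t = h' b" using assms(3) that h'b by auto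
    then have "t = b" using inj_onD[OF ih', of t b] that(2) be by auto
    then show False using that(2) by simp
  qed
  have 2: "inj_on G {a..e}"
  proof (rule inj_onI)
    fix s t assume st: "s \<in> {a..e}" "t \<in> {a..e}" "G s = G t"
    show "s = t"
      using st g(3) ih' cross[of s t] cross[of t s] unfolding G_def inj_on_def
      by (smt (verit) atLeastAtMost_iff greaterThanAtMost_iff)
  qed
  have "G ` {a..e} = G ` {a..b} \<union> G ` {b..e}" by (metis abe image_Un)
  also have "\<dots> = B \<union> C" using Gg Gh g(6) imh' by (metis image_cong)
  finally have 3: "G ` {a..e} = B \<union> C" .
  have "G a = x" "G e = y" using Gg[of a] Gh[of e] g h'b be by auto
  then show ?thesis using arc_betweenI[OF _ 1 2] 3 g(1) be by simp
qed

text \<open>The parameters mapped into the closed set \<open>S\<close> form a compact set, and its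
  least element ends the initial piece. Cutting at a first hit is how arcs that may cross are made
  to meet in a single point.\<close>

lemma arc_between_first_hit:
  assumes "arc_between A x y" "closed S" "y \<in> S"
  obtains z B where "z \<in> S" "arc_between B x z" "B \<subseteq> A" "B \<inter> S = {z}"
proof -
  obtain a b :: real and g where g: "a \<le> b" "continuous_on {a..b} g" "inj_on g {a..b}"
    "g a = x" "g b = y" "g ` {a..b} = A"
    using assms unfolding arc_between_def by blast
  define H where "H = {a..b} \<inter> g -` S"
  have "closed H" unfolding H_def
    by (rule continuous_closed_preimage) (use g assms in auto)
  then have "compact H" unfolding H_def
    by (metis H_def bounded_Int bounded_closed_interval compact_eq_bounded_closed)
  moreover have "b \<in> H" using g assms(3) by (auto simp: H_def)
  ultimately obtain t where t: "t \<in> H" "\<And>s. s \<in> H \<Longrightarrow> t \<le> s"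
    by (metis compact_attains_inf empty_iff)
  have t': "a \<le> t" "t \<le> b" "g t \<in> S" using t by (auto simp: H_def)
  show ?thesis
  proof
    show "g t \<in> S" by fact
    show "arc_between (g ` {a..t}) x (g t)"
      using arc_between_restrict[OF g(2,3), of a t] g(4) t' by simp
    show "g ` {a..t} \<subseteq> A" using g t' by auto
    show "g ` {a..t} \<inter> S = {g t}"
    proof (intro equalityI subsetI)
      fix p assume "p \<in> g ` {a..t} \<inter> S"
      then obtain s where s: "s \<in> {a..t}" "p = g s" "g s \<in> S" by auto
      then have "s \<in> H" using t' by (auto simp: H_def)
      then have "s = t" using s t(2) by force
      then show "p \<in> {g t}" using s by auto
    qed (use t' in auto)
  qed
qed

text \<open>Concatenating \<open>A\<close> and \<open>B\<close> may destroy injectivity. Instead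
  \<open>A\<close> is followed until it first meets \<open>B\<close>, and from there
  \<open>B\<close> is followed to \<open>z\<close>.\<close>

lemma arc_between_trans:
  assumes "arc_between A x y" "arc_between B y z"
  obtains C where "arc_between C x z" "C \<subseteq> A \<union> B"
proof -
  obtain w D where D: "w \<in> B" "arc_between D x w" "D \<subseteq> A" "D \<inter> B = {w}"
    using arc_between_first_hit[OF assms(1) arc_between_closed[OF assms(2)]]
      arc_between_ends[OF assms(2)] by blast
  obtain B1 B2 where B: "arc_between B2 w z" "B = B1 \<union> B2"
    using arc_between_split[OF assms(2) D(1)] by metis
  have "D \<inter> B2 = {w}" using D(4) B(2) arc_between_ends[OF B(1)] D(1) by blast
  then have "arc_between (D \<union> B2) x z" using arc_between_join D(2) B(1) by blast
  moreover have "D \<union> B2 \<subseteq> A \<union> B" using D B by blast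
  ultimately show ?thesis using that by blast
qed

lemma arc_between_subarc:
  assumes "arc_between A x y" "p \<in> A" "q \<in> A"
  obtains B where "arc_between B p q" "B \<subseteq> A"
proof -
  obtain A1 where 1: "arc_between A1 x p" "A1 \<subseteq> A" using arc_between_split[OF assms(1,2)] by blast
  obtain A2 where 2: "arc_between A2 x q" "A2 \<subseteq> A" using arc_between_split[OF assms(1,3)] by blast
  obtain B where "arc_between B p q" "B \<subseteq> A1 \<union> A2"
    using arc_between_trans[OF arc_between_sym[OF 1(1)] 2(1)] .
  then show ?thesis using that 1(2) 2(2) by (meson Un_least order_trans)
qed

lemma arc_between_image:
  assumes "arc_between A x y" "continuous_on A f" "inj_on f A"
  shows "arc_between (f ` A) (f x) (f y)"
proof -
  obtain a b :: real and g where g: "a \<le> b" "continuous_on {a..b} g" "inj_on g {a..b}"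
    "g a = x" "g b = y" "g ` {a..b} = A"
    using assms unfolding arc_between_def by blast
  then have "continuous_on {a..b} (f \<circ> g)" "inj_on (f \<circ> g) {a..b}" "(f \<circ> g) ` {a..b} = f ` A"
    using assms(2,3) by (auto intro!: continuous_on_compose comp_inj_on simp: image_comp[symmetric] simp del: o_apply)
  then show ?thesis using arc_betweenI[of a b "f \<circ> g"] g by simp
qed

lemma arc_between_param:
  assumes "arc_between A x y" "x \<noteq> y"
  obtains g where "arc g" "path_image g = A" "pathstart g = x" "pathfinish g = y"
proof -
  obtain a b :: real and g where g: "a \<le> b" "continuous_on {a..b} g" "inj_on g {a..b}"
    "g a = x" "g b = y" "g ` {a..b} = A"
    using assms unfolding arc_between_def by blast
  have ab: "a < b" using g assms(2) by (metis order_le_less)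
  define s where "s t = (b - a) * t + a" for t
  have s: "s ` {0..1} = {a..b}" "continuous_on {0..1} s" "inj_on s {0..1}"
  proof -
    show "s ` {0..1} = {a..b}"
      using ab image_affinity_atLeastAtMost[of "b - a" a 0 1] by (simp add: s_def[abs_def])
    show "continuous_on {0..1} s" unfolding s_def by (intro continuous_intros)
    show "inj_on s {0..1}" using ab by (intro inj_onI) (simp add: s_def)
  qed
  have "arc (g \<circ> s)" unfolding arc_def path_def
    using s g by (intro conjI continuous_on_compose comp_inj_on) auto
  moreover have "path_image (g \<circ> s) = A" unfolding path_image_def using s g by (metis image_comp)
  ultimately show ?thesis using that[of "g \<circ> s"] g by (auto simp: pathstart_def pathfinish_def s_def)
qed

lemma arc_imp_arc_between: "arc g \<Longrightarrow> arc_between (path_image g) (pathstart g) (pathfinish g)"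
  unfolding arc_def path_def path_image_def pathstart_def pathfinish_def by (simp add: arc_betweenI)

lemma arc_between_iff_arc:
  assumes "x \<noteq> y"
  shows "arc_between A x y \<longleftrightarrow> (\<exists>g. arc g \<and> path_image g = A \<and> pathstart g = x \<and> pathfinish g = y)"
  proof
  assume "arc_between A x y"
  from arc_between_param[OF this assms] show "\<exists>g. arc g \<and> path_image g = A \<and> pathstart g = x \<and> pathfinish g = y"
    by blast
qed (auto dest: arc_imp_arc_between)

section \<open>Arcs and maps in sets without simple closed curves\<close>

definition loopless :: "'a::t2_space set \<Rightarrow> bool" where
  "loopless T \<longleftrightarrow> \<not> (\<exists>g. simple_path g \<and> pathfinish g = pathstart g \<and> path_image g \<subseteq> T)"

lemma loopless_no_double_arc:
  assumes "loopless T" "arc_between A x y" "arc_between B x y" "x \<noteq> y" "A \<inter> B \<subseteq> {x, y}"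
    "A \<subseteq> T" "B \<subseteq> T"
  shows False
proof -
  obtain g where g: "arc g" "path_image g = A" "pathstart g = x" "pathfinish g = y"
    using arc_between_param[OF assms(2,4)] by blast
  obtain h where h: "arc h" "path_image h = B" "pathstart h = y" "pathfinish h = x"
    using arc_between_param[OF arc_between_sym[OF assms(3)] assms(4)[symmetric]] by blast
  have "simple_path (g +++ h)" using simple_path_join_loop[of g h] g h assms by auto
  moreover have "path_image (g +++ h) \<subseteq> T" using path_image_join[of g h] g h assms by auto
  ultimately show False using assms(1) g h unfolding loopless_def
    by (metis pathfinish_join pathstart_join)
qed

text \<open>From a point \<open>p\<close> of \<open>A\<close> outside \<open>B\<close>, both
  directions along \<open>A\<close> are followed until \<open>B\<close> is first met, at
  \<open>u\<close> and \<open>v\<close>. These two pieces and the part of \<open>B\<close> between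
  \<open>u\<close> and \<open>v\<close> would form a simple closed curve.\<close>

lemma loopless_arc_subset:
  assumes T: "loopless T" and A: "arc_between A x y" "A \<subseteq> T" and B: "arc_between B x y" "B \<subseteq> T"
  shows "A \<subseteq> B"
proof
  fix p assume p: "p \<in> A"
  show "p \<in> B"
  proof (rule ccontr)
    assume pB: "p \<notin> B"
    obtain A1 A2 where s: "arc_between A1 x p" "arc_between A2 p y" "A = A1 \<union> A2" "A1 \<inter> A2 = {p}"
      using arc_between_split[OF A(1) p] by metis
    have ends: "x \<in> B" "y \<in> B" "closed B"
      using arc_between_ends[OF B(1)] arc_between_closed[OF B(1)] by auto
    obtain u C where C: "u \<in> B" "arc_between C p u" "C \<subseteq> A1" "C \<inter> B = {u}"
      using arc_between_first_hit[OF arc_between_sym[OF s(1)] ends(3,1)] by metis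
    obtain v D where D: "v \<in> B" "arc_between D p v" "D \<subseteq> A2" "D \<inter> B = {v}"
      using arc_between_first_hit[OF s(2) ends(3,2)] by metis
    have "p \<in> C" "p \<in> D" using arc_between_ends[OF C(2)] arc_between_ends[OF D(2)] by auto
    moreover have "C \<inter> D \<subseteq> A1 \<inter> A2" using C(3) D(3) by auto
    ultimately have CD: "C \<inter> D = {p}" using s(4) by auto
    have "u \<noteq> v"
    proof
      assume "u = v"
      then have "u \<in> C \<inter> D" using arc_between_ends[OF C(2)] arc_between_ends[OF D(2)] by auto
      then show False using CD C(1) pB by auto
    qed
    obtain F where F: "arc_between F u v" "F \<subseteq> B" using arc_between_subarc[OF B(1) C(1) D(1)] .
    have "arc_between (C \<union> D) u v" using arc_between_join[OF arc_between_sym[OF C(2)] D(2) CD] .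
    moreover have "(C \<union> D) \<inter> F \<subseteq> C \<inter> B \<union> D \<inter> B" using F(2) by auto
    then have "(C \<union> D) \<inter> F \<subseteq> {u, v}" unfolding C(4) D(4) by auto
    moreover have "C \<union> D \<subseteq> T" "F \<subseteq> T" using C D F s A B by auto
    ultimately show False using loopless_no_double_arc[OF T _ F(1) \<open>u \<noteq> v\<close>] by blast
  qed
qed

lemma loopless_arc_unique:
  assumes "loopless T" "arc_between A x y" "A \<subseteq> T" "arc_between B x y" "B \<subseteq> T"
  shows "A = B"
  using loopless_arc_subset[OF assms(1,2,3,4,5)] loopless_arc_subset[OF assms(1,4,5,2,3)] by (rule equalityI)

lemma loopless_image_ends_neq:
  assumes "loopless T" "arc_between A x y" "x \<noteq> y" "continuous_on A f" "f ` A \<subseteq> T" "inj_on f (A - {x})"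
  shows "f x \<noteq> f y"
proof
  assume eq: "f x = f y"
  obtain g where g: "arc g" "path_image g = A" "pathstart g = x" "pathfinish g = y"
    using arc_between_param[OF assms(2,3)] by blast
  have g01: "g 0 = x" "g 1 = y" "inj_on g {0..1}" "g ` {0..1} = A"
    using g by (auto simp: pathstart_def pathfinish_def arc_def path_image_def)
  have "loop_free (f \<circ> g)"
    unfolding loop_free_def
  proof (intro ballI impI)
    fix s t :: real assume st: "s \<in> {0..1}" "t \<in> {0..1}" "(f \<circ> g) s = (f \<circ> g) t"
    have eq1: "r = 1" if "r \<in> {0..1}" "f (g r) = f x" "r \<noteq> 0" for r
    proof -
      have "g r \<in> A - {x}" "y \<in> A - {x}" using that g01 assms(3) arc_between_ends[OF assms(2)]
        by (auto simp: inj_on_def)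
      then have "g r = y" using that eq assms(6) by (metis inj_onD)
      then show ?thesis using that g01 by (metis atLeastAtMost_iff inj_onD order_refl zero_le_one)
    qed
    have "s = t" if "s \<noteq> 0" "t \<noteq> 0"
    proof -
      have "g s \<in> A - {x}" "g t \<in> A - {x}" using that st g01 by (auto simp: inj_on_def)
      then have "g s = g t" using st assms(6) by (metis inj_onD comp_apply)
      then show ?thesis using st g01 by (metis inj_onD)
    qed
    then show "s = t \<or> s = 0 \<and> t = 1 \<or> s = 1 \<and> t = 0"
      using eq1[of s] eq1[of t] st g01 by fastforce
  qed
  moreover have "path (f \<circ> g)" using g assms(4) by (intro path_continuous_image) (auto simp: arc_def)
  ultimately have "simple_path (f \<circ> g)" by (simp add: simple_path_def)
  moreover have "path_image (f \<circ> g) \<subseteq> T" using g01 assms(5) by (auto simp: path_image_def)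
  ultimately show False using assms(1) eq g01 unfolding loopless_def
    by (metis comp_apply pathfinish_def pathstart_def)
qed

text \<open>
  Local injectivity bounds \<open>t - s\<close> from below over all pairs \<open>s < t\<close> of parameters with the same
  image. A pair minimizing \<open>t - s\<close> therefore exists, and its image is a simple closed curve.
\<close>

lemma locally_injective_imp_inj_on_arc:
  assumes T: "loopless T" and A: "arc_between A x y" and f: "continuous_on A f" "f ` A \<subseteq> T"
    and loc: "\<And>p. p \<in> A \<Longrightarrow> \<exists>U. openin (top_of_set A) U \<and> p \<in> U \<and> inj_on f U"
  shows "inj_on f A"
proof (rule ccontr)
  assume ninj: "\<not> inj_on f A"
  obtain a b :: real and g where g: "a \<le> b" "continuous_on {a..b} g" "inj_on g {a..b}"
    "g a = x" "g b = y" "g ` {a..b} = A"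
    using A unfolding arc_between_def by blast
  define h where "h = f \<circ> g"
  have ch: "continuous_on {a..b} h" unfolding h_def
    using g(2,6) f(1) by (intro continuous_on_compose) simp_all
  define \<C> where "\<C> = {W. open W \<and> inj_on h (W \<inter> {a..b})}"
  have cov: "\<exists>W\<in>\<C>. t \<in> W" if t: "t \<in> {a..b}" for t
  proof -
    have "g t \<in> A" using t g(6) by blast
    then obtain U where U: "openin (top_of_set A) U" "g t \<in> U" "inj_on f U" using loc by blast
    have "openin (top_of_set {a..b}) ({a..b} \<inter> g -` U)"
      using continuous_openin_preimage[OF g(2) _ U(1)] g(6) by auto
    then obtain W where W: "open W" "{a..b} \<inter> g -` U = {a..b} \<inter> W" unfolding openin_open by auto
    have "inj_on h (W \<inter> {a..b})"
    proof (rule inj_onI)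
      fix s r assume sr: "s \<in> W \<inter> {a..b}" "r \<in> W \<inter> {a..b}" "h s = h r"
      then have "s \<in> {a..b} \<inter> W" "r \<in> {a..b} \<inter> W" by auto
      then have "g s \<in> U" "g r \<in> U" unfolding W(2)[symmetric] by auto
      then have "g s = g r" using sr U(3) by (auto simp: h_def inj_on_def)
      then show "s = r" using g(3) sr by (auto simp: inj_on_def)
    qed
    then show ?thesis using W t U by (auto simp: \<C>_def)
  qed
  \<comment> \<open>The Lebesgue number of the cover by parameter sets on which \<open>h\<close> is
    injective is the lower bound for \<open>t - s\<close>.\<close>
  obtain \<delta> where \<delta>: "\<delta> > 0" "\<And>S. S \<subseteq> {a..b} \<Longrightarrow> diameter S < \<delta> \<Longrightarrow> \<exists>W\<in>\<C>. S \<subseteq> W"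
  proof (rule Lebesgue_number_lemma[of "{a..b}" \<C>])
    show "\<C> \<noteq> {}" using cov[of a] g(1) by auto
    show "{a..b} \<subseteq> \<Union>\<C>" using cov by blast
  qed (use that in \<open>auto simp: \<C>_def\<close>)
  have gap: "\<delta> \<le> t - s" if st: "s \<in> {a..b}" "t \<in> {a..b}" "s < t" "h s = h t" for s t
  proof (rule ccontr)
    assume "\<not> \<delta> \<le> t - s"
    then have "diameter {s..t} < \<delta>" using st by simp
    then obtain W where "W \<in> \<C>" "{s..t} \<subseteq> W" using \<delta>(2)[of "{s..t}"] st(1,2) by fastforce
    then have "inj_on h (W \<inter> {a..b})" "s \<in> W \<inter> {a..b}" "t \<in> W \<inter> {a..b}"
      using st(1-3) by (auto simp: \<C>_def subset_iff)
    then have "s = t" using st(4) by (metis inj_onD)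
    then show False using st(3) by simp
  qed
  \<comment> \<open>\<open>h\<close> is extended to the whole line by clamping the parameter, so
    that the coincidence set in \<open>K\<close> is closed.\<close>
  define h' where "h' t = h (max a (min b t))" for t
  have ch': "continuous_on UNIV h'"
    unfolding h'_def by (rule continuous_on_compose2[OF ch]) (use g(1) in \<open>auto intro!: continuous_intros\<close>)
  have h'h: "h' t = h t" if "t \<in> {a..b}" for t using that by (auto simp: h'_def max_def min_def)
  \<comment> \<open>By \<open>gap\<close>, the closed condition on the difference captures all
    coincidences with \<open>s < t\<close>; this makes the set of such pairs compact.\<close>
  define K where "K = ({a..b} \<times> {a..b}) \<inter> ({p. fst p + \<delta> \<le> snd p} \<inter> {p. h' (fst p) = h' (snd p)})"
  have "closed ({p. fst p + \<delta> \<le> snd p} \<inter> {p. h' (fst p) = h' (snd p)})"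
    by (intro closed_Int closed_Collect_le closed_Collect_eq continuous_intros
          continuous_on_compose2[OF ch']) auto
  then have "compact K" unfolding K_def by (intro compact_Int_closed compact_Times) auto
  moreover have "K \<noteq> {}"
  proof -
    obtain p q where pq: "p \<in> A" "q \<in> A" "p \<noteq> q" "f p = f q" using ninj by (auto simp: inj_on_def)
    then obtain s t where st: "s \<in> {a..b}" "t \<in> {a..b}" "p = g s" "q = g t" using g(6) by blast
    then have "h s = h t" "s \<noteq> t" using pq by (auto simp: h_def)
    then have "(min s t, max s t) \<in> K"
      using gap[of s t] gap[of t s] st h'h by (auto simp: K_def min_def max_def)
    then show ?thesis by auto
  qed
  moreover have "continuous_on K (\<lambda>p. snd p - fst p)" by (intro continuous_intros)
  ultimately obtain z where z: "z \<in> K" "\<And>w. w \<in> K \<Longrightarrow> snd z - fst z \<le> snd w - fst w"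
    using continuous_attains_inf[of K "\<lambda>p. snd p - fst p"] by blast
  obtain s t where zst: "z = (s, t)" by (cases z)
  have st: "a \<le> s" "t \<le> b" "s + \<delta> \<le> t" "h s = h t"
    using z(1) h'h[of s] h'h[of t] by (auto simp: K_def zst)
  have arc: "arc_between {s..t} s t"
    using arc_betweenI[of s t "\<lambda>x. x"] st(3) \<delta>(1) by simp
  \<comment> \<open>A coincidence strictly after \<open>s\<close> would be a pair in
    \<open>K\<close> with a smaller difference.\<close>
  have "inj_on h ({s..t} - {s})"
  proof (rule linorder_inj_onI')
    fix i j assume ij: "i \<in> {s..t} - {s}" "j \<in> {s..t} - {s}" "i < j"
    show "h i \<noteq> h j"
    proof
      assume "h i = h j"
      then have "(i, j) \<in> K" using gap[of i j] ij st h'h by (auto simp: K_def)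
      then show False using z(2)[of "(i, j)"] ij by (auto simp: zst)
    qed
  qed
  moreover have "continuous_on {s..t} h" "h ` {s..t} \<subseteq> T"
    using ch st f(2) g(6) by (auto intro: continuous_on_subset simp: h_def)
  ultimately show False
    using loopless_image_ends_neq[OF T arc _ _ _ , of h] st \<delta>(1) by auto
qed

section \<open>Segments, medians and leaves of a tree\<close>

lemma graph_edge_arc:
  assumes "finite_topological_graph T V E" "e \<in> E"
  obtains a b where "a \<in> V" "b \<in> V" "arc_between e a b" "e \<subseteq> T"
proof -
  obtain g where g: "arc g" "path_image g = e" "e \<inter> V = {pathstart g, pathfinish g}"
    using assms unfolding finite_topological_graph_def by meson
  moreover have "e \<subseteq> T" using assms unfolding finite_topological_graph_def by auto
  moreover have "pathstart g \<in> V" "pathfinish g \<in> V" using g(3) by auto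
  ultimately show ?thesis using that[of "pathstart g" "pathfinish g"] arc_imp_arc_between[OF g(1)] by simp
qed

locale arc_tree =
  fixes T :: "'a::t2_space set"
  assumes tree: "tree T"
begin

abbreviation seg :: "'a \<Rightarrow> 'a \<Rightarrow> 'a set" where "seg \<equiv> tree_arc T"

lemma loopless: "loopless T"
  using tree unfolding tree_def loopless_def by simp

lemma graph: "\<exists>V E. finite_topological_graph T V E"
  using tree unfolding tree_def by (elim conjE)

text \<open>Being joined by an arc in \<open>T\<close> is an equivalence relation, and
  \<open>T\<close> is connected, so it suffices that each point \<open>z\<close> is joined to all
  points of a neighbourhood.\<close>

lemma arc_exists:
  assumes "x \<in> T" "y \<in> T"
  shows "\<exists>A\<subseteq>T. arc_between A x y"
proof -
  obtain V E where G: "finite_topological_graph T V E" using graph by blast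
  define R where "R x y \<longleftrightarrow> (\<exists>A\<subseteq>T. arc_between A x y)" for x y
  have "R x y"
  proof (rule connected_equivalence_relation[of T x y R])
    show "connected T" using tree unfolding tree_def by simp
    fix z assume z: "z \<in> T"
    \<comment> \<open>The edges missing \<open>z\<close> and all other vertices are removed, so
      every remaining point other than \<open>z\<close> lies on an edge through
      \<open>z\<close>.\<close>
    define K where "K = \<Union>{e \<in> E. z \<notin> e} \<union> (V - {z})"
    have "closed e" if "e \<in> E" for e
      using graph_edge_arc[OF G that] arc_between_closed by metis
    then have "closed K" using G unfolding K_def finite_topological_graph_def
      by (intro closed_Un closed_Union finite_imp_closed) auto
    then have "openin (top_of_set T) (T - K)" by (simp add: Diff_eq open_Compl openin_open_Int)
    moreover have "z \<in> T - K" using z by (auto simp: K_def)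
    moreover have "R z w" if w: "w \<in> T - K" for w
    proof (cases "w = z")
      case True
      then show ?thesis using z arc_between_refl[of z] by (auto simp: R_def)
    next
      case False
      then obtain e where e: "e \<in> E" "w \<in> e" "z \<in> e"
        using w G unfolding K_def finite_topological_graph_def by auto
      obtain a b where ab: "arc_between e a b" "e \<subseteq> T" by (rule graph_edge_arc[OF G e(1)])
      obtain B where "arc_between B z w" "B \<subseteq> e" by (rule arc_between_subarc[OF ab(1) e(3,2)])
      then show ?thesis using ab(2) by (auto simp: R_def)
    qed
    ultimately show "\<exists>N. openin (top_of_set T) N \<and> z \<in> N \<and> (\<forall>w\<in>N. R z w)" by blast
  next
    fix p q r assume "R p q" "R q r"
    then obtain A B where AB: "arc_between A p q" "arc_between B q r" "A \<subseteq> T" "B \<subseteq> T"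
      unfolding R_def by blast
    obtain C where "arc_between C p r" "C \<subseteq> A \<union> B" by (rule arc_between_trans[OF AB(1,2)])
    then show "R p r" using AB(3,4) unfolding R_def by (meson Un_least order_trans)
  qed (use assms arc_between_sym in \<open>auto simp: R_def\<close>)
  then show ?thesis by (simp add: R_def)
qed

text \<open>Uniqueness of arcs identifies the definite description in \<open>tree_arc\<close> with
  any arc exhibited in \<open>T\<close>; degenerate arcs fit in as well.\<close>

lemma seg_eqI:
  assumes "arc_between A x y" "A \<subseteq> T"
  shows "seg x y = A"
proof (cases "x = y")
  case True
  then have "A = {x}" using arc_between_same assms(1) by simp
  with True show ?thesis by (simp add: tree_arc_def)
next
  case False
  then have "seg x y = (THE A. A \<subseteq> T \<and> arc_between A x y)"
    by (simp add: tree_arc_def arc_between_iff_arc)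
  also have "\<dots> = A"
  proof (rule the_equality)
    fix B assume "B \<subseteq> T \<and> arc_between B x y"
    then show "B = A" using loopless_arc_unique[OF loopless _ _ assms] by simp
  qed (use assms in simp)
  finally show ?thesis .
qed

lemma seg_arc:
  assumes "x \<in> T" "y \<in> T"
  shows "arc_between (seg x y) x y" "seg x y \<subseteq> T"
  using arc_exists[OF assms] seg_eqI by auto

lemma seg_refl [simp]: "seg x x = {x}"
  by (simp add: tree_arc_def)

lemma seg_ends: "x \<in> T \<Longrightarrow> y \<in> T \<Longrightarrow> x \<in> seg x y \<and> y \<in> seg x y"
  using seg_arc arc_between_ends by blast

lemma seg_in_T: "p \<in> seg x y \<Longrightarrow> x \<in> T \<Longrightarrow> y \<in> T \<Longrightarrow> p \<in> T"
  using seg_arc by blast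

lemma seg_sym: "x \<in> T \<Longrightarrow> y \<in> T \<Longrightarrow> seg x y = seg y x"
  using seg_arc[of y x] seg_eqI arc_between_sym by blast

lemma seg_split:
  assumes "x \<in> T" "y \<in> T" "z \<in> seg x y"
  shows "seg x y = seg x z \<union> seg z y" "seg x z \<inter> seg z y = {z}"
proof -
  obtain B C where BC: "arc_between B x z" "arc_between C z y" "seg x y = B \<union> C" "B \<inter> C = {z}"
    by (rule arc_between_split[OF seg_arc(1)[OF assms(1,2)] assms(3)])
  have "B \<subseteq> T" "C \<subseteq> T" using BC(3) seg_arc(2)[OF assms(1,2)] by auto
  then have "seg x z = B" "seg z y = C" using seg_eqI BC by auto
  then show "seg x y = seg x z \<union> seg z y" "seg x z \<inter> seg z y = {z}" using BC by auto
qed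

lemma seg_triangle:
  assumes "x \<in> T" "y \<in> T" "z \<in> T"
  shows "seg x y \<subseteq> seg x z \<union> seg z y"
proof -
  obtain C where C: "arc_between C x y" "C \<subseteq> seg x z \<union> seg z y"
    by (rule arc_between_trans[OF seg_arc(1)[OF assms(1,3)] seg_arc(1)[OF assms(3,2)]])
  moreover have "C \<subseteq> T" using C(2) seg_arc(2)[OF assms(1,3)] seg_arc(2)[OF assms(3,2)] by auto
  ultimately show ?thesis using seg_eqI by auto
qed

lemma seg_join:
  assumes "x \<in> T" "y \<in> T" "z \<in> T" "seg x z \<inter> seg z y \<subseteq> {z}"
  shows "seg x y = seg x z \<union> seg z y" "z \<in> seg x y"
proof -
  have z: "z \<in> seg x z" "z \<in> seg z y" using assms seg_ends by auto
  then have "seg x z \<inter> seg z y = {z}" using assms(4) by auto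
  then have "arc_between (seg x z \<union> seg z y) x y"
    using arc_between_join seg_arc(1) assms by metis
  moreover have "seg x z \<union> seg z y \<subseteq> T" using seg_arc(2) assms by auto
  ultimately show "seg x y = seg x z \<union> seg z y" by (rule seg_eqI)
  then show "z \<in> seg x y" using z by simp
qed

lemma seg_sub:
  assumes "x \<in> T" "y \<in> T" "p \<in> seg x y" "q \<in> seg x y"
  shows "seg p q \<subseteq> seg x y"
proof -
  obtain B where B: "arc_between B p q" "B \<subseteq> seg x y"
    by (rule arc_between_subarc[OF seg_arc(1)[OF assms(1,2)] assms(3,4)])
  then show ?thesis using seg_eqI[of B p q] seg_arc(2)[OF assms(1,2)] by auto
qed

lemma seg_antisym:
  assumes "p \<in> T" "q \<in> T" "z \<in> T" "q \<in> seg p z" "p \<in> seg q z"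
  shows "p = q"
proof -
  have "p \<in> seg p q" using assms seg_ends by auto
  then show ?thesis using seg_split(2)[OF assms(1,3,4)] assms(5) by auto
qed

text \<open>Either \<open>q\<close> comes before \<open>p\<close> on the way from \<open>x\<close>,
  and \<open>seg_antisym\<close> applies, or \<open>seg p q\<close> is contained in
  \<open>seg p b\<close>, which meets \<open>seg x p\<close> only in \<open>p\<close>.\<close>

lemma seg_ray:
  assumes "x \<in> T" "b \<in> T" "p \<in> seg x b" "q \<in> seg x b" "p \<noteq> x" "q \<noteq> x"
  shows "x \<notin> seg p q"
proof
  assume x: "x \<in> seg p q"
  have T: "p \<in> T" "q \<in> T" using assms seg_in_T by auto
  have *: False if "q' \<in> seg x p'" "x \<in> seg p' q'" "q' \<noteq> x" "p' \<in> T" "q' \<in> T" for p' q'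
    using seg_antisym[of q' x p'] that assms(1) seg_sym by metis
  have "q \<in> seg x p \<or> q \<in> seg p b" using seg_split(1)[OF assms(1,2,3)] assms(4) by auto
  then show False
  proof
    assume "q \<in> seg x p"
    then show False using * x T assms(6) by blast
  next
    assume q: "q \<in> seg p b"
    have "seg p q \<subseteq> seg p b" using seg_sub[OF T(1) assms(2) _ q] seg_ends T assms(2) by auto
    then have "x \<in> seg p b" "x \<in> seg x p" using x seg_ends T assms(1) by auto
    then show False using seg_split(2)[OF assms(1,2,3)] assms(5) by auto
  qed
qed

text \<open>
  Deleting finitely many closed pieces leaves a neighbourhood of \<open>z\<close> whose points are joined to
  \<open>z\<close> inside a single edge without meeting \<open>x\<close>; this replaces local connectedness of \<open>T\<close>.
\<close>

lemma seg_nbhd: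
  assumes z: "z \<in> T" and x: "x \<in> T" "x \<noteq> z"
  shows "\<exists>K. closed K \<and> z \<notin> K \<and> (\<forall>w\<in>T - K. x \<notin> seg z w)"
proof -
  obtain V E where G: "finite_topological_graph T V E" using graph by blast
  have "\<exists>K. closed K \<and> z \<notin> K \<and> (\<forall>w\<in>e - K. x \<notin> seg z w)" if e: "e \<in> E" for e
  proof -
    obtain a b where ab: "arc_between e a b" "e \<subseteq> T" by (rule graph_edge_arc[OF G e])
    have T: "a \<in> T" "b \<in> T" and es: "e = seg a b"
      using ab arc_between_ends seg_eqI[OF ab] by auto
    \<comment> \<open>If \<open>x\<close> separates \<open>z\<close> from the end \<open>a'\<close>
      of the edge, removing \<open>seg a' x\<close> leaves only points on the far side of
      \<open>x\<close>, where \<open>seg_ray\<close> applies.\<close>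
    have end_case: "\<exists>K. closed K \<and> z \<notin> K \<and> (\<forall>w\<in>e - K. x \<notin> seg z w)"
      if "e = seg a' b'" "a' \<in> T" "b' \<in> T" "x \<in> seg a' z" "z \<in> e" for a' b'
    proof (intro exI[of _ "seg a' x"] conjI ballI)
      show "closed (seg a' x)" using seg_arc(1) arc_between_closed that x by blast
      show nz: "z \<notin> seg a' x"
        using seg_split(2)[OF that(2) z that(4)] seg_ends[OF x(1) z] x(2) by auto
      fix w assume w: "w \<in> e - seg a' x"
      have "x \<in> seg a' b'" using seg_sub[of a' b' a' z] that seg_ends by auto
      then have s: "e = seg a' x \<union> seg x b'" using seg_split(1) that by auto
      then have "w \<in> seg x b'" "z \<in> seg x b'" "w \<noteq> x" using w nz that seg_ends x by auto
      then show "x \<notin> seg z w" using seg_ray[OF x(1) that(3)] x(2) by auto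
    qed
    show ?thesis
    proof (cases "z \<in> e")
      case False
      then show ?thesis using ab(1) arc_between_closed by (intro exI[of _ e]) auto
    next
      case ze: True
      show ?thesis
      proof (cases "x \<in> e")
        case False
        have "x \<notin> seg z w" if "w \<in> e" for w using seg_sub[of a b z w] T es ze that False by auto
        then show ?thesis by (intro exI[of _ "{}"]) auto
      next
        case True
        then have "x \<in> seg a z \<or> x \<in> seg b z"
          using seg_split(1)[of a b z] T es ze seg_sym[OF T(2) z] by auto
        then show ?thesis using end_case[of a b] end_case[of b a] T es ze seg_sym[OF T] by auto
      qed
    qed
  qed
  then obtain K where K: "\<And>e. e \<in> E \<Longrightarrow> closed (K e) \<and> z \<notin> K e \<and> (\<forall>w\<in>e - K e. x \<notin> seg z w)"
    by metis
  show ?thesis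
  proof (intro exI[of _ "\<Union>(K ` E) \<union> (V - {z})"] conjI ballI)
    show "closed (\<Union>(K ` E) \<union> (V - {z}))" using G K unfolding finite_topological_graph_def
      by (intro closed_Un closed_UN finite_imp_closed) auto
    show "z \<notin> \<Union>(K ` E) \<union> (V - {z})" using K by auto
    fix w assume w: "w \<in> T - (\<Union>(K ` E) \<union> (V - {z}))"
    then have "w = z \<or> (\<exists>e\<in>E. w \<in> e)" using G unfolding finite_topological_graph_def by auto
    then show "x \<notin> seg z w" using w K x(2) by fastforce
  qed
qed

text \<open>This translates arms into betweenness. A connected set avoiding \<open>x\<close> cannot
  contain points separated by \<open>x\<close>, because not being separated by \<open>x\<close> is
  an equivalence relation on it and \<open>seg_nbhd\<close> makes the classes open.\<close>

lemma connected_component_minus_point_iff: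
  assumes "x \<in> T" "y \<in> T - {x}" "z \<in> T - {x}"
  shows "connected_component (T - {x}) y z \<longleftrightarrow> x \<notin> seg y z"
proof
  assume "x \<notin> seg y z"
  then have "seg y z \<subseteq> T - {x}" "connected (seg y z)"
    using seg_arc[of y z] assms arc_between_connected by auto
  then show "connected_component (T - {x}) y z"
    using seg_ends[of y z] assms unfolding connected_component_def by blast
next
  assume "connected_component (T - {x}) y z"
  then obtain S where S: "connected S" "S \<subseteq> T - {x}" "y \<in> S" "z \<in> S"
    unfolding connected_component_def by blast
  show "x \<notin> seg y z"
  proof (rule connected_equivalence_relation[OF S(1,3,4), of "\<lambda>p q. x \<notin> seg p q"])
    fix p q r assume "x \<notin> seg p q" "x \<notin> seg q r" "p \<in> S" "q \<in> S" "r \<in> S"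
    moreover from this have "p \<in> T" "q \<in> T" "r \<in> T" using S(2) by auto
    ultimately show "x \<notin> seg p r" using seg_triangle[of p r q] by auto
  next
    fix p assume p: "p \<in> S"
    then have "p \<in> T" "x \<noteq> p" using S(2) by auto
    from seg_nbhd[OF this(1) assms(1) this(2)]
    obtain K where K: "closed K" "p \<notin> K" "\<forall>w\<in>T - K. x \<notin> seg p w" by auto
    have "openin (top_of_set S) (S - K)" using K(1) by (simp add: Diff_eq open_Compl openin_open_Int)
    then show "\<exists>N. openin (top_of_set S) N \<and> p \<in> N \<and> (\<forall>w\<in>N. x \<notin> seg p w)"
      using K(2,3) p S(2) by (intro exI[of _ "S - K"]) auto
  next
    fix p q assume pq: "x \<notin> seg p q" "p \<in> S" "q \<in> S"
    then have "p \<in> T" "q \<in> T" using S(2) by auto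
    then show "x \<notin> seg q p" using seg_sym[of q p] pq(1) by simp
  qed
qed

section \<open>Medians\<close>

lemma median_first_arg:
  assumes "x \<in> T" "y \<in> T" "z \<in> T"
    and m: "m \<in> seg x y" "m \<in> seg y z" "m \<in> seg x z"
    and m': "m' \<in> seg x y" "m' \<in> seg y z" "m' \<in> seg x z"
    and "m' \<in> seg m y"
  shows "m = m'"
proof -
  have T: "m \<in> T" "m' \<in> T" using assms seg_in_T by auto
  have "m' \<in> seg x m \<or> m' \<in> seg m z" using seg_split(1)[OF assms(1,3) m(3)] m'(3) by auto
  then show ?thesis
  proof
    assume "m' \<in> seg x m"
    then show ?thesis using seg_split(2)[OF assms(1,2) m(1)] assms(10) by auto
  next
    assume a: "m' \<in> seg m z"
    have "m \<in> seg y m' \<or> m \<in> seg m' z" using seg_split(1)[OF assms(2,3) m'(2)] m(2) by auto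
    then show ?thesis
    proof
      assume "m \<in> seg y m'"
      then have "m \<in> seg m' y" using seg_sym[OF T(2) assms(2)] by simp
      then show ?thesis using seg_antisym[OF T assms(2,10)] by simp
    next
      assume "m \<in> seg m' z"
      then show ?thesis using seg_antisym[OF T assms(3) a] by simp
    qed
  qed
qed

text \<open>The point \<open>m'\<close> lies on one of the two sides of \<open>m\<close> on
  \<open>seg x y\<close>; exchanging \<open>x\<close> and \<open>y\<close> reduces both cases to
  \<open>median_first_arg\<close>.\<close>

lemma median_unique:
  assumes "x \<in> T" "y \<in> T" "z \<in> T"
    and m: "m \<in> seg x y" "m \<in> seg y z" "m \<in> seg x z"
    and m': "m' \<in> seg x y" "m' \<in> seg y z" "m' \<in> seg x z"
  shows "m = m'"
proof -
  have T: "m \<in> T" "m' \<in> T" using assms seg_in_T by auto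
  have "m' \<in> seg x m \<or> m' \<in> seg m y" using seg_split(1)[OF assms(1,2) m(1)] m'(1) by auto
  then show ?thesis
  proof
    assume "m' \<in> seg x m"
    then have "m' \<in> seg m x" using seg_sym[OF assms(1) T(1)] by simp
    then show ?thesis
      using median_first_arg[OF assms(2,1,3), of m m'] m m' seg_sym[OF assms(1,2)] by simp
  qed (rule median_first_arg[OF assms])
qed

text \<open>The median is the first point at which the arc from \<open>z\<close> to \<open>x\<close>
  meets \<open>seg x y\<close>. The piece up to it touches \<open>seg x y\<close> nowhere else and
  so can be prolonged to either end.\<close>

lemma median_exists:
  assumes "x \<in> T" "y \<in> T" "z \<in> T"
  shows "\<exists>m. m \<in> seg x y \<and> m \<in> seg y z \<and> m \<in> seg x z"
proof -
  have cl: "closed (seg x y)" using arc_between_closed[OF seg_arc(1)[OF assms(1,2)]] .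
  have xs: "x \<in> seg x y" using seg_ends assms by auto
  obtain m B where B: "m \<in> seg x y" "arc_between B z m" "B \<subseteq> seg z x" "B \<inter> seg x y = {m}"
    by (rule arc_between_first_hit[OF seg_arc(1)[OF assms(3,1)] cl xs])
  have m: "m \<in> T" using B(1) assms seg_in_T by auto
  have Bs: "seg z m = B" using B(2,3) seg_arc(2)[OF assms(3,1)] by (intro seg_eqI) auto
  have ends: "x \<in> seg x y" "y \<in> seg x y" using assms seg_ends by auto
  have "seg z m \<inter> seg m x \<subseteq> {m}" "seg z m \<inter> seg m y \<subseteq> {m}"
    using seg_sub[OF assms(1,2) B(1) ends(1)] seg_sub[OF assms(1,2) B(1) ends(2)] Bs B(4) by auto
  then have "m \<in> seg z x" "m \<in> seg z y" using seg_join(2) assms m by auto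
  then show ?thesis using B(1) seg_sym[OF assms(3,1)] seg_sym[OF assms(3,2)] by auto
qed

definition med :: "'a \<Rightarrow> 'a \<Rightarrow> 'a \<Rightarrow> 'a" where
  "med x y z = (THE m. m \<in> seg x y \<and> m \<in> seg y z \<and> m \<in> seg x z)"

lemma med_eqI:
  assumes "x \<in> T" "y \<in> T" "z \<in> T" "m \<in> seg x y" "m \<in> seg y z" "m \<in> seg x z"
  shows "med x y z = m"
  unfolding med_def
proof (rule the_equality)
  fix m' assume "m' \<in> seg x y \<and> m' \<in> seg y z \<and> m' \<in> seg x z"
  then show "m' = m" using median_unique[OF assms(1-3), of m' m] assms(4-6) by simp
qed (use assms(4-6) in simp)

lemma med_props:
  assumes "x \<in> T" "y \<in> T" "z \<in> T"
  shows "med x y z \<in> seg x y" "med x y z \<in> seg y z" "med x y z \<in> seg x z" "med x y z \<in> T"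
proof -
  obtain m where m: "m \<in> seg x y" "m \<in> seg y z" "m \<in> seg x z"
    using median_exists[OF assms] by blast
  then have "med x y z = m" by (rule med_eqI[OF assms])
  then show "med x y z \<in> seg x y" "med x y z \<in> seg y z" "med x y z \<in> seg x z" "med x y z \<in> T"
    using m seg_in_T assms by auto
qed

lemma med_swap:
  assumes "x \<in> T" "y \<in> T" "z \<in> T"
  shows "med y x z = med x y z" "med x z y = med x y z"
  using med_props[OF assms] seg_sym[OF assms(1,2)] seg_sym[OF assms(2,3)]
  by (auto intro!: med_eqI assms)

lemma med_self: "x \<in> T \<Longrightarrow> z \<in> T \<Longrightarrow> med x x z = x"
  using seg_ends[of x z] by (intro med_eqI) auto

text \<open>Betweenness becomes an equation between points, so a bijection compatible with medians
  also respects betweenness.\<close>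

lemma in_seg_iff_med:
  assumes "x \<in> T" "y \<in> T" "z \<in> T"
  shows "z \<in> seg x y \<longleftrightarrow> med x y z = z"
  using med_eqI[OF assms] med_props[OF assms] seg_ends[OF assms(2,3)] seg_ends[OF assms(1,3)] by metis

section \<open>Leaves and branch points\<close>

definition leaf :: "'a \<Rightarrow> bool" where
  "leaf e \<longleftrightarrow> e \<in> T \<and> (\<forall>p\<in>T - {e}. \<forall>q\<in>T - {e}. e \<notin> seg p q)"

text \<open>The point \<open>y\<close> excludes a one-point tree, whose only point is a leaf but has
  no arm.\<close>

lemma leaf_imp_endpoint:
  assumes "leaf e" "y \<in> T" "y \<noteq> e"
  shows "e \<in> endpoints T"
proof -
  have e: "e \<in> T" using assms leaf_def by simp
  have "connected (T - {e})"
    unfolding connected_iff_connected_component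
    using connected_component_minus_point_iff[OF e] assms(1) unfolding leaf_def by simp
  then have "components (T - {e}) = {T - {e}}" using assms by (subst components_eq_sing_iff) auto
  then show ?thesis using e by (simp add: endpoints_def arms_def)
qed

text \<open>The two halves of an edge through \<open>y\<close> meet only in \<open>y\<close>, so one
  of them leads to a vertex without passing \<open>x\<close>. Counting vertices then gives
  finiteness of the arms and the induction that finds leaves.\<close>

lemma vertex_in_arm:
  assumes G: "finite_topological_graph T V E" and x: "x \<in> T" "y \<in> T" "x \<noteq> y"
  shows "\<exists>v\<in>V - {x}. x \<notin> seg y v"
proof (cases "y \<in> V")
  case True
  then show ?thesis using x by (intro bexI[of _ y]) auto
next
  case False
  then obtain e where e: "e \<in> E" "y \<in> e" using x G unfolding finite_topological_graph_def by auto
  obtain a b where ab: "a \<in> V" "b \<in> V" "arc_between e a b" "e \<subseteq> T" by (rule graph_edge_arc[OF G e(1)])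
  have T: "a \<in> T" "b \<in> T" and es: "e = seg a b"
    using ab arc_between_ends seg_eqI[OF ab(3,4)] by auto
  have y: "y \<in> seg a b" using e es by simp
  have "seg a y \<inter> seg y b = {y}" using seg_split(2)[OF T y] .
  then have "x \<notin> seg a y \<or> x \<notin> seg y b" using x(3) by auto
  then show ?thesis
  proof
    assume "x \<notin> seg a y"
    then show ?thesis using seg_sym[OF T(1) x(2)] seg_ends[OF T(1) x(2)] ab(1) by (intro bexI[of _ a]) auto
  next
    assume "x \<notin> seg y b"
    then show ?thesis using seg_ends[OF x(2) T(2)] ab(2) by (intro bexI[of _ b]) auto
  qed
qed

text \<open>Every arm contains a vertex. Finiteness matters because \<open>card\<close> is
  \<open>0\<close> on infinite sets, so three distinct arms alone would not bound it below.\<close>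

lemma finite_arms:
  assumes x: "x \<in> T"
  shows "finite (arms T x)"
proof -
  obtain V E where G: "finite_topological_graph T V E" using graph by blast
  have VT: "V \<subseteq> T" using G unfolding finite_topological_graph_def by auto
  have "arms T x \<subseteq> connected_component_set (T - {x}) ` V"
  proof
    fix A assume "A \<in> arms T x"
    then obtain y where y: "y \<in> T - {x}" "A = connected_component_set (T - {x}) y"
      unfolding arms_def components_def by auto
    have "x \<noteq> y" using y(1) by auto
    then obtain v where v: "v \<in> V - {x}" "x \<notin> seg y v" using vertex_in_arm[OF G x] y(1) by auto
    then have "connected_component (T - {x}) y v"
      using connected_component_minus_point_iff[OF x y(1), of v] VT by auto
    then have "A = connected_component_set (T - {x}) v"
      using y(2) connected_component_eq by (metis mem_Collect_eq)
    then show "A \<in> connected_component_set (T - {x}) ` V" using v(1) by auto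
  qed
  moreover have "finite V" using G unfolding finite_topological_graph_def by simp
  ultimately show ?thesis using finite_subset by blast
qed

lemma not_in_seg_trans:
  assumes "p \<in> T" "q \<in> T" "r \<in> T" "x \<notin> seg p q" "x \<notin> seg q r"
  shows "x \<notin> seg p r"
  using seg_triangle[OF assms(1,3,2)] assms(4,5) by auto

lemma branch_point_iff:
  assumes x: "x \<in> T"
  shows "x \<in> branch_points T \<longleftrightarrow>
    (\<exists>p\<in>T - {x}. \<exists>q\<in>T - {x}. \<exists>r\<in>T - {x}. x \<in> seg p q \<and> x \<in> seg q r \<and> x \<in> seg p r)"
    (is "_ \<longleftrightarrow> ?R")
proof -
  let ?C = "connected_component_set (T - {x})"
  have eq: "?C p = ?C q \<longleftrightarrow> x \<notin> seg p q" if "p \<in> T - {x}" "q \<in> T - {x}" for p q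
    using connected_component_minus_point_iff[OF x that] that connected_component_eq_eq[of "T - {x}" p q]
    by simp
  have arm: "arms T x = ?C ` (T - {x})" by (auto simp: arms_def components_def)
  show ?thesis
  proof
    assume "x \<in> branch_points T"
    then have "3 \<le> card (arms T x)" by (simp add: branch_points_def)
    then obtain \<A> where "\<A> \<subseteq> arms T x" "card \<A> = 3" by (meson obtain_subset_with_card_n)
    then obtain A B D where ABD: "A \<in> arms T x" "B \<in> arms T x" "D \<in> arms T x" "A \<noteq> B" "B \<noteq> D" "A \<noteq> D"
      by (auto simp: card_3_iff)
    then obtain p q r where pqr: "p \<in> T - {x}" "q \<in> T - {x}" "r \<in> T - {x}" "A = ?C p" "B = ?C q" "D = ?C r"
      unfolding arm by blast
    then have "x \<in> seg p q" "x \<in> seg q r" "x \<in> seg p r" using ABD(4-6) eq by metis+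
    then show ?R using pqr(1-3) by blast
  next
    assume ?R
    then obtain p q r where pqr: "p \<in> T - {x}" "q \<in> T - {x}" "r \<in> T - {x}"
      "x \<in> seg p q" "x \<in> seg q r" "x \<in> seg p r" by blast
    then have "?C p \<noteq> ?C q" "?C q \<noteq> ?C r" "?C p \<noteq> ?C r" using eq by metis+
    then have "card {?C p, ?C q, ?C r} = 3" by simp
    moreover have "{?C p, ?C q, ?C r} \<subseteq> arms T x" using pqr arm by auto
    ultimately have "3 \<le> card (arms T x)" using card_mono[OF finite_arms[OF x]] by metis
    then show "x \<in> branch_points T" using x by (simp add: branch_points_def)
  qed
qed

text \<open>
  A vertex \<open>v\<close> in the arm that is not a leaf has a further arm inside the given one, and that arm
  contains fewer vertices since it misses \<open>v\<close>.
\<close>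

lemma arm_contains_leaf:
  assumes "x \<in> T" "y \<in> T" "x \<noteq> y"
  shows "\<exists>e. leaf e \<and> x \<notin> seg y e"
proof -
  obtain V E where G: "finite_topological_graph T V E" using graph by blast
  have V: "V \<subseteq> T" "finite V" using G unfolding finite_topological_graph_def by auto
  define W where "W x y = {v \<in> V - {x}. x \<notin> seg y v}" for x y
  show ?thesis using assms
  proof (induction "card (W x y)" arbitrary: x y rule: less_induct)
    case less
    obtain v where v: "v \<in> V - {x}" "x \<notin> seg y v" using vertex_in_arm[OF G less.prems] by auto
    have vT: "v \<in> T" using v V by auto
    show ?case
    proof (cases "leaf v")
      case True
      then show ?thesis using v by blast
    next
      case False
      then obtain p q where pq: "p \<in> T - {v}" "q \<in> T - {v}" "v \<in> seg p q"
        using vT unfolding leaf_def by auto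
      have "\<exists>p\<in>T - {v}. v \<in> seg p x"
      proof (rule ccontr)
        assume a: "\<not> ?thesis"
        then have "v \<notin> seg p x" "v \<notin> seg q x" using pq by auto
        moreover have "seg q x = seg x q" using seg_sym pq less.prems by simp
        ultimately show False using not_in_seg_trans[of p x q v] pq less.prems by auto
      qed
      then obtain p where p: "p \<in> T" "p \<noteq> v" "v \<in> seg p x" by auto
      have far: "x \<notin> seg y u" if u: "u \<in> T" "v \<notin> seg p u" for u
      proof -
        have "v \<in> seg u x" using not_in_seg_trans[of p u x v] u p less.prems by auto
        then have "x \<notin> seg v u"
          using seg_antisym[of x v u] seg_sym[OF u(1) less.prems(1)] less.prems(1) vT u(1) v(1) by auto
        then show ?thesis using not_in_seg_trans[of y v u x] v(2) less.prems vT u by auto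
      qed
      have "W v p \<subseteq> W x y"
      proof
        fix u assume "u \<in> W v p"
        then have u: "u \<in> V" "v \<notin> seg p u" by (auto simp: W_def)
        then have f: "x \<notin> seg y u" using far V by auto
        moreover have "u \<noteq> x" using f seg_ends[of y u] less.prems u(1) V by auto
        ultimately show "u \<in> W x y" using u by (auto simp: W_def)
      qed
      moreover have "v \<in> W x y" "v \<notin> W v p" using v by (auto simp: W_def)
      ultimately have "W v p \<subset> W x y" by auto
      moreover have "finite (W x y)" using V by (simp add: W_def)
      ultimately have "card (W v p) < card (W x y)" by (simp add: psubset_card_mono)
      then obtain e where "leaf e" "v \<notin> seg p e" using less.hyps[of v p] vT p by auto
      then show ?thesis using far[of e] unfolding leaf_def by auto
    qed
  qed
qed

text \<open>A leaf is chosen in each of three arms at \<open>b\<close>. Moving points within their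
  arms does not change whether \<open>b\<close> separates them, so \<open>b\<close> is the median of
  the leaves.\<close>

lemma branch_point_med_leaves:
  assumes b: "b \<in> branch_points T"
  shows "\<exists>p q r. leaf p \<and> leaf q \<and> leaf r \<and> b = med p q r"
proof -
  have bT: "b \<in> T" using b by (simp add: branch_points_def)
  then obtain p q r where pqr: "p \<in> T - {b}" "q \<in> T - {b}" "r \<in> T - {b}"
    "b \<in> seg p q" "b \<in> seg q r" "b \<in> seg p r" using b branch_point_iff by blast
  obtain p' where p': "leaf p'" "b \<notin> seg p p'" using arm_contains_leaf[OF bT, of p] pqr(1) by auto
  obtain q' where q': "leaf q'" "b \<notin> seg q q'" using arm_contains_leaf[OF bT, of q] pqr(2) by auto
  obtain r' where r': "leaf r'" "b \<notin> seg r r'" using arm_contains_leaf[OF bT, of r] pqr(3) by auto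
  have T: "p' \<in> T" "q' \<in> T" "r' \<in> T" using p' q' r' by (auto simp: leaf_def)
  have *: "b \<in> seg s' t'" if "s \<in> T" "t \<in> T" "s' \<in> T" "t' \<in> T" "b \<in> seg s t" "b \<notin> seg s s'" "b \<notin> seg t t'"
    for s t s' t'
    using not_in_seg_trans[of s s' t' b] not_in_seg_trans[of s t' t b] seg_sym[of t t'] that by auto
  have "b \<in> seg p' q'" "b \<in> seg q' r'" "b \<in> seg p' r'"
    using *[of p q p' q'] *[of q r q' r'] *[of p r p' r'] pqr p' q' r' T by auto
  then show ?thesis using med_eqI T p' q' r' by metis
qed

lemma med_cases:
  assumes "x \<in> T" "y \<in> T" "z \<in> T"
  shows "med x y z \<in> {x, y, z} \<union> branch_points T"
proof -
  note m = med_props[OF assms]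
  show ?thesis
  proof (cases "med x y z \<in> {x, y, z}")
    case False
    then have "\<exists>p\<in>T - {med x y z}. \<exists>q\<in>T - {med x y z}. \<exists>r\<in>T - {med x y z}.
        med x y z \<in> seg p q \<and> med x y z \<in> seg q r \<and> med x y z \<in> seg p r"
      using assms m by (intro bexI[of _ x] bexI[of _ y] bexI[of _ z]) auto
    then show ?thesis using branch_point_iff[OF m(4)] by simp
  qed auto
qed

end

section \<open>Hubbard trees\<close>

locale hubbard =
  fixes T :: "'a::t2_space set" and f :: "'a \<Rightarrow> 'a" and c :: 'a
  assumes hubbard: "hubbard_tree T f c"
begin

sublocale arc_tree T
  using hubbard unfolding hubbard_tree_def by unfold_locales blast

lemma c_in_T: "c \<in> T" and cont_f: "continuous_on T f" and surj_f: "f ` T = T"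
  and endpoints_critical: "endpoints T \<subseteq> critical_orbit f c" and fc_neq: "f c \<noteq> c"
  and expansive: "\<lbrakk>x \<in> marked_points T f c; y \<in> marked_points T f c; x \<noteq> y\<rbrakk>
        \<Longrightarrow> \<exists>n. c \<in> (f ^^ n) ` seg x y"
  using hubbard unfolding hubbard_tree_def by blast+

lemma at_most_two_preimages:
  assumes "y \<in> T" shows "finite {x \<in> T. f x = y}" "card {x \<in> T. f x = y} \<le> 2"
  using hubbard assms unfolding hubbard_tree_def by blast+

lemma locally_injective:
  assumes "x \<in> T" "x \<noteq> c"
  shows "\<exists>U. openin (top_of_set T) U \<and> x \<in> U \<and> inj_on f U"
proof -
  have "\<forall>x\<in>T - {c}. \<exists>U g. openin (top_of_set T) U \<and> x \<in> U \<and> homeomorphism U (f ` U) f g"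
    using hubbard unfolding hubbard_tree_def by (elim conjE)
  then obtain U g where U: "openin (top_of_set T) U" "x \<in> U" "homeomorphism U (f ` U) f g"
    using assms by blast
  then have "inj_on f U" unfolding homeomorphism_def by (metis inj_on_inverseI)
  then show ?thesis using U by blast
qed

lemma f_in_T: "x \<in> T \<Longrightarrow> f x \<in> T"
  using surj_f by auto

lemma funpow_in_T: "x \<in> T \<Longrightarrow> (f ^^ n) x \<in> T"
  by (induction n) (auto intro: f_in_T)

section \<open>The map on arcs, leaves and arms of the critical point\<close>

lemma inj_on_seg:
  assumes "x \<in> T" "y \<in> T" "c \<notin> seg x y"
  shows "inj_on f (seg x y)"
proof (rule locally_injective_imp_inj_on_arc[OF loopless seg_arc(1)[OF assms(1,2)]])
  note sub = seg_arc(2)[OF assms(1,2)]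
  show "continuous_on (seg x y) f" using cont_f sub continuous_on_subset by blast
  show "f ` seg x y \<subseteq> T" using sub f_in_T by blast
  fix p assume p: "p \<in> seg x y"
  then have "p \<in> T" "p \<noteq> c" using sub assms(3) by auto
  then obtain U where U: "openin (top_of_set T) U" "p \<in> U" "inj_on f U"
    using locally_injective by blast
  have "openin (top_of_set (seg x y)) (U \<inter> seg x y)"
    using U(1) sub by (metis inf.absorb_iff2 inf_commute openin_subtopology_Int subtopology_subtopology)
  moreover have "inj_on f (U \<inter> seg x y)" using U(3) inj_on_subset by blast
  ultimately show "\<exists>U. openin (top_of_set (seg x y)) U \<and> p \<in> U \<and> inj_on f U"
    using U(2) p by blast
qed

text \<open>Two points of the arc other than \<open>c\<close> are joined by an arc avoiding
  \<open>c\<close>, where \<open>f\<close> is injective. A second point with the image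
  \<open>f c\<close> would turn the image of an arc into a simple closed curve.\<close>

lemma inj_on_seg_critical:
  assumes y: "y \<in> T"
  shows "inj_on f (seg c y)"
proof -
  note cT = c_in_T
  have main: "f p \<noteq> f q" if pq: "p \<in> seg c y" "q \<in> seg c y" "p \<noteq> q" "p \<noteq> c" "q \<noteq> c" for p q
  proof -
    have T: "p \<in> T" "q \<in> T" using pq seg_in_T cT y by auto
    have "inj_on f (seg p q)"
      using inj_on_seg[OF T] seg_ray[OF cT y pq(1,2,4,5)] by simp
    then show ?thesis using seg_ends[OF T] pq(3) by (metis inj_onD)
  qed
  have crit: "f c \<noteq> f q" if q: "q \<in> seg c y" "c \<noteq> q" for q
  proof -
    have qT: "q \<in> T" using q seg_in_T cT y by auto
    note sub = seg_arc(2)[OF cT qT]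
    have "seg c q \<subseteq> seg c y" using seg_sub[OF cT y _ q(1)] seg_ends[OF cT y] by auto
    then have "p \<in> seg c y \<and> p \<noteq> c" if "p \<in> seg c q - {c}" for p using that by auto
    then have "inj_on f (seg c q - {c})" using main by (meson inj_onI)
    moreover have "continuous_on (seg c q) f" using cont_f sub continuous_on_subset by blast
    moreover have "f ` seg c q \<subseteq> T" using sub f_in_T by blast
    ultimately show ?thesis using loopless_image_ends_neq[OF loopless seg_arc(1)[OF cT qT] q(2)] by blast
  qed
  show ?thesis
  proof (rule inj_onI, rule ccontr)
    fix p q assume "p \<in> seg c y" "q \<in> seg c y" "f p = f q" "p \<noteq> q"
    then show False using main[of p q] crit[of p] crit[of q] by metis
  qed
qed

lemma image_seg:
  assumes "x \<in> T" "y \<in> T" "inj_on f (seg x y)"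
  shows "f ` seg x y = seg (f x) (f y)"
proof -
  note sub = seg_arc(2)[OF assms(1,2)]
  have "continuous_on (seg x y) f" using cont_f sub continuous_on_subset by blast
  then have "arc_between (f ` seg x y) (f x) (f y)"
    using arc_between_image seg_arc(1)[OF assms(1,2)] assms(3) by blast
  moreover have "f ` seg x y \<subseteq> T" using sub f_in_T by blast
  ultimately show ?thesis using seg_eqI by simp
qed

lemma exists_near:
  assumes "x \<in> T" "y \<in> T" "x \<noteq> y" "x \<noteq> c"
  shows "\<exists>y'\<in>seg x y. y' \<noteq> x \<and> c \<notin> seg x y'"
proof (cases "c \<in> seg x y")
  case False
  then show ?thesis using assms(3) seg_ends[OF assms(1,2)] by (intro bexI[of _ y]) auto
next
  case True
  have "arc_between (seg x c) x c" using seg_arc assms c_in_T by blast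
  then obtain a b :: real and g where g: "a \<le> b" "inj_on g {a..b}" "g a = x" "g b = c" "g ` {a..b} = seg x c"
    unfolding arc_between_def by blast
  have "a \<noteq> b" using g(3,4) assms(4) by auto
  define t where "t = (a + b) / 2"
  have t: "a < t" "t < b" using g(1) \<open>a \<noteq> b\<close> by (auto simp: t_def field_simps)
  have "g t \<noteq> g a" "g t \<noteq> g b" using t inj_onD[OF g(2), of t a] inj_onD[OF g(2), of t b] by auto
  then have y': "g t \<in> seg x c" "g t \<noteq> x" "g t \<noteq> c" using t g(3-5) by auto
  have yT: "g t \<in> T" using y'(1) seg_in_T assms(1) c_in_T by auto
  have "c \<in> seg (g t) c" using seg_ends[OF yT c_in_T] by simp
  then have "c \<notin> seg x (g t)"
    using seg_split(2)[OF assms(1) c_in_T y'(1)] y'(3) by (metis IntI singletonD)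
  moreover have "g t \<in> seg x y" using seg_split(1)[OF assms(1,2) True] y'(1) by auto
  ultimately show ?thesis using y'(2) by blast
qed

text \<open>The two sides of \<open>x\<close> on an arc through it can be shortened until the arc
  avoids \<open>c\<close>. There \<open>f\<close> is injective, so \<open>f x\<close> is an interior
  point of the image arc.\<close>

lemma f_preserves_non_leaf:
  assumes "x \<in> T" "\<not> leaf x" "x \<noteq> c"
  shows "\<not> leaf (f x)"
proof -
  obtain y z where yz: "y \<in> T" "y \<noteq> x" "z \<in> T" "z \<noteq> x" "x \<in> seg y z"
    using assms unfolding leaf_def by auto
  obtain y' where y': "y' \<in> seg x y" "y' \<noteq> x" "c \<notin> seg x y'"
    using exists_near[of x y] assms yz by auto
  obtain z' where z': "z' \<in> seg x z" "z' \<noteq> x" "c \<notin> seg x z'"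
    using exists_near[of x z] assms yz by auto
  have T: "y' \<in> T" "z' \<in> T" using y' z' seg_in_T assms yz by auto
  have "seg x y' \<subseteq> seg x y" "seg x z' \<subseteq> seg x z"
    using seg_sub[of x y x y'] seg_sub[of x z x z'] y' z' assms(1) yz seg_ends by auto
  moreover have "seg x y \<inter> seg x z = {x}"
    using seg_split(2)[OF yz(1,3,5)] seg_sym[OF assms(1) yz(1)] by simp
  ultimately have "seg y' x \<inter> seg x z' \<subseteq> {x}" using seg_sym[OF T(1) assms(1)] by auto
  then have j: "seg y' z' = seg y' x \<union> seg x z'" "x \<in> seg y' z'"
    using seg_join[OF T assms(1)] by auto
  then have "c \<notin> seg y' z'" using y'(3) z'(3) seg_sym[OF T(1) assms(1)] by auto
  then have inj: "inj_on f (seg y' z')" using inj_on_seg T by simp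
  have "f x \<in> seg (f y') (f z')" using image_seg[OF T inj] j(2) by auto
  moreover have "f y' \<noteq> f x" "f z' \<noteq> f x" using inj j(2) seg_ends[OF T] y'(2) z'(2) by (metis inj_onD)+
  ultimately show ?thesis using T f_in_T unfolding leaf_def by auto
qed

lemma leaf_critical:
  assumes "leaf e" shows "\<exists>k. e = (f ^^ k) c"
proof -
  have "\<exists>y\<in>T. y \<noteq> e" using c_in_T f_in_T fc_neq by metis
  then have "e \<in> endpoints T" using leaf_imp_endpoint[OF assms] by auto
  then show ?thesis using endpoints_critical unfolding critical_orbit_def by auto
qed

text \<open>
  Otherwise no \<open>c\<^sub>k\<close> with \<open>k \<ge> 1\<close> is a leaf, although an arm of the critical point contains a
  leaf, which lies on the critical orbit and is not \<open>c\<^sub>0\<close>.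
\<close>

lemma critical_value_leaf: "leaf (f c)"
proof (rule ccontr)
  assume nl: "\<not> leaf (f c)"
  have nleaf: "\<not> leaf ((f ^^ Suc k) c)" for k
  proof (induction k)
    case (Suc k)
    then show ?case
      using f_preserves_non_leaf[of "(f ^^ Suc k) c"] funpow_in_T[OF c_in_T, of "Suc k"] nl
      by (cases "(f ^^ Suc k) c = c") auto
  qed (use nl in simp)
  obtain e where e: "leaf e" "c \<notin> seg (f c) e"
    using arm_contains_leaf[of c "f c"] c_in_T f_in_T fc_neq by auto
  obtain k where k: "e = (f ^^ k) c" using leaf_critical[OF e(1)] by auto
  have "e \<noteq> c" using e(2) seg_ends[of "f c" c] c_in_T f_in_T by auto
  then obtain j where "k = Suc j" using k by (cases k) auto
  then show False using nleaf k e(1) by auto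
qed

text \<open>
  Since the critical value is an endpoint, the images of arcs from \<open>c\<close> into three different arms
  would overlap near \<open>f c\<close>, giving a point with three preimages.
\<close>

lemma critical_two_arms:
  assumes "p \<in> T - {c}" "q \<in> T - {c}" "r \<in> T - {c}" "c \<in> seg p q" "c \<in> seg q r" "c \<in> seg p r"
  shows False
proof -
  have inj: "inj_on f (seg c y)" "f ` seg c y = seg (f c) (f y)" "f y \<noteq> f c" "f y \<in> T" if "y \<in> T - {c}" for y
  proof -
    show 1: "inj_on f (seg c y)" using inj_on_seg_critical that by simp
    show "f ` seg c y = seg (f c) (f y)" using image_seg 1 that c_in_T by simp
    show "f y \<noteq> f c" using 1 seg_ends[of c y] that c_in_T by (metis DiffE inj_onD singletonI)
    show "f y \<in> T" using that f_in_T by simp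
  qed
  have fcT: "f c \<in> T" using c_in_T f_in_T by simp
  \<comment> \<open>Since \<open>f c\<close> is a leaf, it does not lie between \<open>y\<close> and
    \<open>z\<close>, so the median of the three points is a second common point of the two arcs
    leaving \<open>f c\<close>.\<close>
  have common: "\<exists>w\<in>T. w \<noteq> f c \<and> w \<in> seg (f c) y \<and> w \<in> seg (f c) z"
    if "y \<in> T" "y \<noteq> f c" "z \<in> T" "z \<noteq> f c" for y z
  proof -
    have "f c \<notin> seg y z" using critical_value_leaf that unfolding leaf_def by auto
    then show ?thesis using med_props[OF fcT that(1,3)] by (intro bexI[of _ "med (f c) y z"]) auto
  qed
  obtain v where v: "v \<in> T" "v \<noteq> f c" "v \<in> seg (f c) (f p)" "v \<in> seg (f c) (f q)"
    using common[OF inj(4,3)[OF assms(1)] inj(4,3)[OF assms(2)]] by auto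
  \<comment> \<open>A second application, to \<open>v\<close> and \<open>f r\<close>, yields a point
    on all three image arcs.\<close>
  obtain w where w: "w \<in> T" "w \<noteq> f c" "w \<in> seg (f c) v" "w \<in> seg (f c) (f r)"
    using common[OF v(1,2) inj(4,3)[OF assms(3)]] by auto
  have fe: "f c \<in> seg (f c) (f p)" "f c \<in> seg (f c) (f q)" 
    using seg_ends[OF fcT inj(4)[OF assms(1)]] seg_ends[OF fcT inj(4)[OF assms(2)]] by auto
  have "w \<in> seg (f c) (f p)" "w \<in> seg (f c) (f q)"
    using seg_sub[OF fcT inj(4)[OF assms(1)] fe(1) v(3)] seg_sub[OF fcT inj(4)[OF assms(2)] fe(2) v(4)] w(3)
    by auto
  then have "w \<in> f ` seg c p" "w \<in> f ` seg c q" "w \<in> f ` seg c r" using w(4) inj(2)[OF assms(1)] inj(2)[OF assms(2)] inj(2)[OF assms(3)] by auto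
  then obtain p' q' r' where p': "p' \<in> seg c p" "w = f p'" and q': "q' \<in> seg c q" "w = f q'"
    and r': "r' \<in> seg c r" "w = f r'" by blast
  have n: "p' \<noteq> c" "q' \<noteq> c" "r' \<noteq> c" using p' q' r' w(2) by auto
  have meet: "seg c y \<inter> seg c z = {c}" if "c \<in> seg y z" "y \<in> T - {c}" "z \<in> T - {c}" for y z
    using seg_split(2)[of y z c] seg_sym[of c y] that c_in_T by auto
  have "p' \<noteq> q'" "q' \<noteq> r'" "p' \<noteq> r'"
    using meet[OF assms(4,1,2)] meet[OF assms(5,2,3)] meet[OF assms(6,1,3)] n p'(1) q'(1) r'(1) by auto
  then have "card {p', q', r'} = 3" by simp
  moreover have "{p', q', r'} \<subseteq> {x \<in> T. f x = w}" using p' q' r' seg_in_T c_in_T assms by auto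
  ultimately have "3 \<le> card {x \<in> T. f x = w}" using card_mono[OF at_most_two_preimages(1)[OF w(1)]] by metis
  then show False using at_most_two_preimages(2)[OF w(1)] by simp
qed

section \<open>Symbols, itineraries and medians\<close>

abbreviation sym :: "'a \<Rightarrow> symbol" where "sym \<equiv> symbol_of T f c"
abbreviation itin :: "'a \<Rightarrow> nat \<Rightarrow> symbol" where "itin \<equiv> itinerary T f c"
abbreviation M :: "'a set" where "M \<equiv> marked_points T f c"

lemma sym_Star_iff: "sym x = Star \<longleftrightarrow> x = c"
  by (simp add: symbol_of_def)

lemma sym_pigeonhole:
  "x = c \<or> y = c \<or> z = c \<or> sym x = sym y \<or> sym x = sym z \<or> sym y = sym z"
  by (cases "sym x"; cases "sym y"; cases "sym z") (simp_all add: sym_Star_iff)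

lemma sym_One_iff:
  assumes "x \<in> T" "x \<noteq> c"
  shows "sym x = One \<longleftrightarrow> c \<notin> seg (f c) x"
  using assms connected_component_minus_point_iff[OF c_in_T, of "f c" x] f_in_T c_in_T fc_neq
  by (simp add: symbol_of_def)

text \<open>Points with symbol \<open>One\<close> share an arm by definition; those with symbol
  \<open>Zero\<close> do so because \<open>critical_two_arms\<close> leaves at most one arm besides
  that of \<open>f c\<close>.\<close>

lemma sym_eq_iff:
  assumes "x \<in> T" "x \<noteq> c" "y \<in> T" "y \<noteq> c"
  shows "sym x = sym y \<longleftrightarrow> c \<notin> seg x y"
proof -
  have fT: "f c \<in> T" using c_in_T f_in_T by simp
  have "sym x \<noteq> Star" "sym y \<noteq> Star" using assms sym_Star_iff by auto
  then have "sym x = sym y \<longleftrightarrow> (sym x = One \<longleftrightarrow> sym y = One)" by (metis symbol.exhaust)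
  also have "\<dots> \<longleftrightarrow> (c \<notin> seg (f c) x \<longleftrightarrow> c \<notin> seg (f c) y)" using sym_One_iff assms by simp
  also have "\<dots> \<longleftrightarrow> c \<notin> seg x y"
    using not_in_seg_trans[of "f c" x y c] not_in_seg_trans[of "f c" y x c] not_in_seg_trans[of x "f c" y c]
      critical_two_arms[of "f c" x y] seg_sym[of x y] seg_sym[of x "f c"] assms fT fc_neq by auto
  finally show ?thesis .
qed

text \<open>
  Points of \<open>T\<close> in the other arm are seen from \<open>x\<close> and \<open>y\<close> through \<open>c\<close>, so \<open>z\<close> may be replaced
  by \<open>c\<close>; after that, \<open>f\<close> is injective on all three sides of the tripod.
\<close>

lemma f_med_same_arm:
  assumes "x \<in> T" "y \<in> T" "x \<noteq> c" "y \<noteq> c" "sym x = sym y" "z \<in> T"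
  defines "z' \<equiv> (if sym z = sym x then z else c)"
  shows "sym (med x y z) = sym x" "f (med x y z) = med (f x) (f y) (f z')"
proof -
  have xy: "c \<notin> seg x y" using sym_eq_iff assms by simp
  have z'T: "z' \<in> T" using assms(6) c_in_T by (simp add: z'_def)
  note m = med_props[OF assms(1,2,6)]
  have mc: "med x y z \<noteq> c" using m(1) xy by auto
  have "seg x (med x y z) \<subseteq> seg x y" using seg_sub[OF assms(1,2) _ m(1)] seg_ends assms(1,2) by auto
  then have "c \<notin> seg x (med x y z)" using xy by auto
  then show "sym (med x y z) = sym x" using sym_eq_iff[OF assms(1,3) m(4) mc] by simp
  have mz': "med x y z = med x y z'"
  proof (cases "sym z = sym x \<or> z = c")
    case True
    then show ?thesis by (auto simp: z'_def)
  next
    case False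
    then have "c \<in> seg x z" "c \<in> seg y z" "z' = c"
      using sym_eq_iff[of x z] sym_eq_iff[of y z] assms(1-6) by (auto simp: z'_def)
    then have "seg x c \<subseteq> seg x z" "seg y c \<subseteq> seg y z"
      using seg_split(1) assms(1,2,6) by blast+
    then show ?thesis
      using med_props[OF assms(1,2) z'T] \<open>z' = c\<close> med_eqI[OF assms(1,2,6)] by blast
  qed
  have inj: "inj_on f (seg w z')" if "w \<in> T" "w \<noteq> c" "sym w = sym x" for w
  proof (cases "sym z = sym x")
    case True
    then have "z \<noteq> c" using sym_Star_iff assms(3) by metis
    then show ?thesis using True that sym_eq_iff[of w z] inj_on_seg[of w z] assms(6) by (simp add: z'_def)
  next
    case False
    then show ?thesis using inj_on_seg_critical[OF that(1)] seg_sym[OF that(1) c_in_T] by (simp add: z'_def)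
  qed
  note m' = med_props[OF assms(1,2) z'T]
  have "f (med x y z') \<in> f ` seg x y" "f (med x y z') \<in> f ` seg y z'" "f (med x y z') \<in> f ` seg x z'"
    using m' by auto
  then have "med (f x) (f y) (f z') = f (med x y z')"
    using image_seg[OF assms(1,2) inj_on_seg[OF assms(1,2) xy]]
      image_seg[OF assms(1) z'T inj[OF assms(1,3)]] image_seg[OF assms(2) z'T inj[OF assms(2,4)]] assms(5)
      assms(1,2) z'T f_in_T
    by (intro med_eqI) auto
  then show "f (med x y z) = med (f x) (f y) (f z')" using mz' by simp
qed

lemma med_critical_between:
  assumes "x \<in> T" "y \<in> T" "x \<noteq> c" "y \<noteq> c" "sym x \<noteq> sym y"
  shows "med x y c = c"
  using sym_eq_iff[OF assms(1,3,2,4)] assms(5) in_seg_iff_med[OF assms(1,2) c_in_T] by simp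

lemma itin_0: "itin x 0 = sym x" and itin_Suc: "itin x (Suc n) = itin (f x) n"
  by (simp_all add: itinerary_def funpow_swap1)

lemma itin_inj_on_marked:
  assumes "x \<in> M" "y \<in> M" "x \<in> T" "y \<in> T" "itin x = itin y"
  shows "x = y"
proof (rule ccontr)
  assume ne: "x \<noteq> y"
  \<comment> \<open>Distinctness is carried along because a common symbol \<open>Star\<close> would
    make both images equal to \<open>c\<close>. The image of the whole arc is tracked since
    expansivity speaks of iterated images of arcs.\<close>
  have *: "(f ^^ n) x \<noteq> (f ^^ n) y \<and> (f ^^ n) ` seg x y = seg ((f ^^ n) x) ((f ^^ n) y)
      \<and> c \<notin> seg ((f ^^ n) x) ((f ^^ n) y)" for n
  proof (induction n)
    case 0
    have "sym x = sym y" using assms(5) itin_0 by metis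
    moreover from this have "x \<noteq> c \<and> y \<noteq> c" using sym_Star_iff ne by metis
    ultimately show ?case using sym_eq_iff assms ne by simp
  next
    case (Suc n)
    let ?x = "(f ^^ n) x" and ?y = "(f ^^ n) y"
    have T: "?x \<in> T" "?y \<in> T" using funpow_in_T assms by auto
    have inj: "inj_on f (seg ?x ?y)" using inj_on_seg T Suc by simp
    then have ne: "f ?x \<noteq> f ?y" using Suc seg_ends[OF T] by (metis inj_onD)
    have "sym (f ?x) = sym (f ?y)" using fun_cong[OF assms(5), of "Suc n"] by (simp add: itinerary_def)
    moreover from this have "f ?x \<noteq> c \<and> f ?y \<noteq> c" using sym_Star_iff ne by metis
    ultimately have "c \<notin> seg (f ?x) (f ?y)" using sym_eq_iff T f_in_T by simp
    moreover have "(f ^^ Suc n) ` seg x y = seg (f ?x) (f ?y)"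
      using Suc image_seg[OF T inj] image_image[of f "f ^^ n" "seg x y"] by simp
    ultimately show ?case using ne by simp
  qed
  show False using expansive[OF assms(1,2) ne] * by auto
qed

section \<open>Marked points and their invariance\<close>

lemma marked_in_T: "x \<in> M \<Longrightarrow> x \<in> T"
  using funpow_in_T[OF c_in_T] by (auto simp: marked_points_def branch_points_def critical_orbit_def)

lemma critical_orbit_marked: "(f ^^ k) c \<in> M"
  by (auto simp: marked_points_def critical_orbit_def)

lemma marked_closed_med: "\<lbrakk>x \<in> M; y \<in> M; z \<in> M\<rbrakk> \<Longrightarrow> med x y z \<in> M"
  using med_cases[of x y z] marked_in_T by (auto simp: marked_points_def)

text \<open>Branch points are medians of leaves, which lie on the critical orbit, and an orbit point
  is a degenerate median. Later arguments can thus treat all marked points alike.\<close>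

lemma marked_as_med:
  assumes "x \<in> M"
  shows "\<exists>i j k. x = med ((f ^^ i) c) ((f ^^ j) c) ((f ^^ k) c)"
proof (cases "x \<in> branch_points T")
  case True
  then show ?thesis using branch_point_med_leaves leaf_critical by metis
next
  case False
  then obtain k where "x = (f ^^ k) c" using assms by (auto simp: marked_points_def critical_orbit_def)
  then show ?thesis using med_self funpow_in_T[OF c_in_T] by metis
qed

text \<open>At most one of the points is \<open>c\<close>, since otherwise the median is
  \<open>c\<close> too; if one is \<open>c\<close>, the other two cannot lie in different arms. If
  none is, two of them share a symbol. Reordering prepares the use of
  \<open>f_med_same_arm\<close>.\<close>

lemma med_eq_c_or_same_arm:
  assumes "x \<in> T" "y \<in> T" "z \<in> T" "med x y z \<noteq> c"
  obtains p q r where "p \<in> {x, y, z}" "q \<in> {x, y, z}" "r \<in> {x, y, z}" "med x y z = med p q r"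
    "p \<noteq> c" "q \<noteq> c" "sym p = sym q"
proof -
  have yz: "y \<noteq> c" if "x = c" using assms that med_self[of c z] by auto
  have zy: "z \<noteq> c" if "x = c"
    using assms that med_self[of c y] med_swap[OF assms(1-3)] by auto
  have zx: "z \<noteq> c" if "y = c"
    using assms that med_self[of c x] med_swap[OF assms(1-3)] med_swap[OF assms(2,1,3)] by auto
  have neq: "p = c \<or> q = c \<or> r \<noteq> c \<or> sym p = sym q"
    if "p \<in> T" "q \<in> T" "med p q r = med x y z" for p q r
    using med_critical_between[of p q] that assms(4) by metis
  have perm: "med x z y = med x y z" "med y z x = med x y z"
    using med_swap[OF assms(1-3)] med_swap(2)[OF assms(2,1,3)] by simp_all
  consider "x \<noteq> c" "y \<noteq> c" "sym x = sym y" | "x \<noteq> c" "z \<noteq> c" "sym x = sym z"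
    | "y \<noteq> c" "z \<noteq> c" "sym y = sym z"
    using yz zy zx sym_pigeonhole[of x y z] neq[OF assms(1,2) refl] neq[OF assms(1,3) perm(1)] neq[OF assms(2,3) perm(2)]
    by argo
  then show ?thesis
  proof cases
    case 1
    then show ?thesis by (intro that[of x y z]) simp_all
  next
    case 2
    then show ?thesis using perm(1) by (intro that[of x z y]) simp_all
  next
    case 3
    then show ?thesis using perm(2) by (intro that[of y z x]) simp_all
  qed
qed

text \<open>A marked point other than \<open>c\<close> is a median of orbit points, two of them in
  the same arm of \<open>c\<close>. By \<open>f_med_same_arm\<close> its image is again such a
  median, since the possible replacement \<open>c\<close> of the third point is on the
  orbit.\<close>

lemma f_marked:
  assumes "x \<in> M"
  shows "f x \<in> M"
proof (cases "x = c")
  case True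
  then show ?thesis using critical_orbit_marked[of 1] by simp
next
  case False
  define C where "C = critical_orbit f c"
  have C: "f p \<in> C" "p \<in> T" "p \<in> M" if p: "p \<in> C" for p
  proof -
    obtain k where k: "p = (f ^^ k) c" using p by (auto simp: C_def critical_orbit_def)
    then have "f p = (f ^^ Suc k) c" by simp
    then show "f p \<in> C" unfolding C_def critical_orbit_def by blast
    show "p \<in> T" "p \<in> M" using k funpow_in_T[OF c_in_T] critical_orbit_marked by auto
  qed
  have cC: "c \<in> C" unfolding C_def critical_orbit_def by (auto intro: exI[of _ 0])
  obtain i j k where "x = med ((f ^^ i) c) ((f ^^ j) c) ((f ^^ k) c)" using marked_as_med[OF assms] by blast
  then obtain u v w where u: "x = med u v w" "u \<in> C" "v \<in> C" "w \<in> C"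
    unfolding C_def critical_orbit_def by blast
  have "med u v w \<noteq> c" using False u(1) by simp
  from med_eq_c_or_same_arm[OF C(2)[OF u(2)] C(2)[OF u(3)] C(2)[OF u(4)] this]
  obtain p q r where pqr: "p \<in> {u, v, w}" "q \<in> {u, v, w}" "r \<in> {u, v, w}"
    "med u v w = med p q r" "p \<noteq> c" "q \<noteq> c" "sym p = sym q" .
  then have p: "p \<in> C" "q \<in> C" "r \<in> C" "x = med p q r" "p \<noteq> c" "q \<noteq> c" "sym p = sym q"
    using u by auto
  have "f x = med (f p) (f q) (f (if sym r = sym p then r else c))"
    using f_med_same_arm(2)[OF C(2)[OF p(1)] C(2)[OF p(2)] p(5-7) C(2)[OF p(3)]] p(4) by simp
  moreover have "(if sym r = sym p then r else c) \<in> C" using p(3) cC by simp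
  then have "med (f p) (f q) (f (if sym r = sym p then r else c)) \<in> M"
    using C(1,3) p(1,2) by (intro marked_closed_med) simp_all
  ultimately show ?thesis by simp
qed

end

section \<open>Trees with the same kneading sequence\<close>

locale hubbard_pair = H: hubbard T f c + H': hubbard T' f' c'
  for T :: "'a::t2_space set" and f c and T' :: "'b::t2_space set" and f' c' +
  assumes same_kneading: "kneading_sequence T f c = kneading_sequence T' f' c'"
begin

text \<open>The itinerary of the critical point is \<open>Star\<close> followed by the kneading
  sequence; those of its iterates are shifts of it.\<close>

lemma itin_critical: "H.itin ((f ^^ k) c) = H'.itin ((f' ^^ k) c')"
proof (induction k)
  case 0
  have "H.itin c n = H'.itin c' n" for n
  proof (cases n)
    case (Suc m)
    then show ?thesis using H.itin_Suc H'.itin_Suc same_kneading by (simp add: kneading_sequence_def)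
  qed (simp add: H.itin_0 H'.itin_0 symbol_of_def)
  then show ?case by auto
next
  case (Suc k)
  have "H.itin (f ((f ^^ k) c)) n = H'.itin (f' ((f' ^^ k) c')) n" for n
    using fun_cong[OF Suc, of "Suc n"] by (simp add: H.itin_Suc H'.itin_Suc)
  then show ?case by auto
qed

text \<open>A relation instead of a function, since only marked points are shown to be determined by
  their itineraries.\<close>

definition matched :: "'a \<Rightarrow> 'b \<Rightarrow> bool" where
  "matched x x' \<longleftrightarrow> x \<in> T \<and> x' \<in> T' \<and> H.itin x = H'.itin x'"

lemma matched_c: "matched c c'"
  using itin_critical[of 0] H.c_in_T H'.c_in_T by (simp add: matched_def)

lemma matched_sym: "matched x x' \<Longrightarrow> H.sym x = H'.sym x'"
  unfolding matched_def using H.itin_0 H'.itin_0 by metis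

lemma matched_f: "matched x x' \<Longrightarrow> matched (f x) (f' x')"
  unfolding matched_def using H.itin_Suc H'.itin_Suc H.f_in_T H'.f_in_T by (metis ext)

lemma matched_eq_c: "matched x x' \<Longrightarrow> x = c \<longleftrightarrow> x' = c'"
  using matched_sym H.sym_Star_iff H'.sym_Star_iff by metis

text \<open>Induction on the position \<open>n\<close> of the symbol. The symbols of the three
  points decide which case occurs, hence the same case in both trees: either both medians are
  critical, or the symbol at \<open>0\<close> is known and applying the maps lowers
  \<open>n\<close>, with new matched points.\<close>

lemma itin_med:
  assumes "matched x x'" "matched y y'" "matched z z'"
  shows "H.itin (H.med x y z) n = H'.itin (H'.med x' y' z') n"
  using assms
proof (induction n arbitrary: x x' y y' z z' rule: less_induct)
  case (less n)
  have same_arm: "H.itin (H.med x y z) n = H'.itin (H'.med x' y' z') n"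
    if m: "matched x x'" "matched y y'" "matched z z'" and s: "x \<noteq> c" "y \<noteq> c" "H.sym x = H.sym y"
    for x y z x' y' z'
  proof -
    have T: "x \<in> T" "y \<in> T" "z \<in> T" "x' \<in> T'" "y' \<in> T'" "z' \<in> T'" using m by (auto simp: matched_def)
    have s': "x' \<noteq> c'" "y' \<noteq> c'" "H'.sym x' = H'.sym y'"
      using s m matched_sym matched_eq_c by metis+
    note A = H.f_med_same_arm[OF T(1,2) s T(3)] and A' = H'.f_med_same_arm[OF T(4,5) s' T(6)]
    show ?thesis
    proof (cases n)
      case 0
      then show ?thesis using A(1) A'(1) matched_sym[OF m(1)] by (simp add: H.itin_0 H'.itin_0)
    next
      case (Suc k)
      \<comment> \<open>Equal symbols force the same choice between third point and critical point
        in both trees, so the chosen points are matched again.\<close>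
      have "matched (if H.sym z = H.sym x then z else c) (if H'.sym z' = H'.sym x' then z' else c')"
        using m matched_sym matched_c by auto
      then show ?thesis
        unfolding Suc H.itin_Suc H'.itin_Suc A(2) A'(2)
        using less.IH[of k] Suc m matched_f by simp
    qed
  qed
  have crit: "H.itin c n = H'.itin c' n" using matched_c by (simp add: matched_def)
  have T: "x \<in> T" "y \<in> T" "z \<in> T" "x' \<in> T'" "y' \<in> T'" "z' \<in> T'" using less.prems by (auto simp: matched_def)
  have perm: "H.med x z y = H.med x y z" "H.med y z x = H.med x y z"
    "H'.med x' z' y' = H'.med x' y' z'" "H'.med y' z' x' = H'.med x' y' z'"
    using H.med_swap(2)[OF T(1-3)] H.med_swap(2)[OF T(2,1,3)] H.med_swap(1)[OF T(1-3)]
      H'.med_swap(2)[OF T(4-6)] H'.med_swap(2)[OF T(5,4,6)] H'.med_swap(1)[OF T(4-6)] by simp_all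
  have two_crit: "H.itin (H.med x y z) n = H'.itin (H'.med x' y' z') n"
    if "H.med x y z = c" "H'.med x' y' z' = c'" using that crit by simp
  note e = matched_eq_c[OF less.prems(1)] matched_eq_c[OF less.prems(2)] matched_eq_c[OF less.prems(3)]
  note q = matched_sym[OF less.prems(1)] matched_sym[OF less.prems(2)] matched_sym[OF less.prems(3)]
  \<comment> \<open>Either two points share an arm, or two coincide with \<open>c\<close>, or
    exactly one is \<open>c\<close> and separates the others; in the last two situations the median
    is \<open>c\<close>.\<close>
  consider (xy) "x \<noteq> c" "y \<noteq> c" "H.sym x = H.sym y"
    | (xz) "x \<noteq> c" "z \<noteq> c" "H.sym x = H.sym z"
    | (yz) "y \<noteq> c" "z \<noteq> c" "H.sym y = H.sym z"
    | (cxy) "x = c" "y = c" | (cxz) "x = c" "z = c" | (cyz) "y = c" "z = c"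
    | (z) "z = c" "x \<noteq> c" "y \<noteq> c" "H.sym x \<noteq> H.sym y"
    | (y) "y = c" "x \<noteq> c" "z \<noteq> c" "H.sym x \<noteq> H.sym z"
    | (x) "x = c" "y \<noteq> c" "z \<noteq> c" "H.sym y \<noteq> H.sym z"
    using H.sym_pigeonhole[of x y z] by argo
  then show ?case
  proof cases
    case xy
    then show ?thesis using same_arm less.prems by simp
  next
    case xz
    then show ?thesis using same_arm[OF less.prems(1,3,2)] perm by simp
  next
    case yz
    then show ?thesis using same_arm[OF less.prems(2,3,1)] perm by simp
  next
    case cxy
    then have "H.med x y z = c" "H'.med x' y' z' = c'" using H.med_self H'.med_self T e by simp_all
    then show ?thesis by (rule two_crit)
  next
    case cxz
    then have "H.med x z y = c" "H'.med x' z' y' = c'" using H.med_self H'.med_self T e by simp_all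
    then show ?thesis using two_crit perm by simp
  next
    case cyz
    then have "H.med y z x = c" "H'.med y' z' x' = c'" using H.med_self H'.med_self T e by simp_all
    then show ?thesis using two_crit perm by simp
  next
    case z
    then have "H.med x y z = c" "H'.med x' y' z' = c'"
      using H.med_critical_between[of x y] H'.med_critical_between[of x' y'] T e q by simp_all
    then show ?thesis by (rule two_crit)
  next
    case y
    then have "H.med x z y = c" "H'.med x' z' y' = c'"
      using H.med_critical_between[of x z] H'.med_critical_between[of x' z'] T e q by simp_all
    then show ?thesis using two_crit perm by simp
  next
    case x
    then have "H.med y z x = c" "H'.med y' z' x' = c'"
      using H.med_critical_between[of y z] H'.med_critical_between[of y' z'] T e q by simp_all
    then show ?thesis using two_crit perm by simp
  qed
qed

lemma matched_med:
  assumes "matched x x'" "matched y y'" "matched z z'"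
  shows "matched (H.med x y z) (H'.med x' y' z')"
proof -
  have "x \<in> T" "y \<in> T" "z \<in> T" "x' \<in> T'" "y' \<in> T'" "z' \<in> T'" using assms by (auto simp: matched_def)
  then have "H.med x y z \<in> T" "H'.med x' y' z' \<in> T'" using H.med_props(4) H'.med_props(4) by auto
  then show ?thesis using itin_med[OF assms] by (auto simp: matched_def)
qed

text \<open>The same median expression, with the same exponents, is formed in the other
  tree.\<close>

lemma marked_matched_exists:
  assumes "x \<in> H.M"
  shows "\<exists>x'\<in>H'.M. matched x x'"
proof -
  obtain i j k where x: "x = H.med ((f ^^ i) c) ((f ^^ j) c) ((f ^^ k) c)" using H.marked_as_med[OF assms] by blast
  have "matched ((f ^^ n) c) ((f' ^^ n) c')" for n
    using itin_critical H.funpow_in_T[OF H.c_in_T] H'.funpow_in_T[OF H'.c_in_T] by (simp add: matched_def)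
  then have "matched x (H'.med ((f' ^^ i) c') ((f' ^^ j) c') ((f' ^^ k) c'))"
    unfolding x by (intro matched_med)
  then show ?thesis using H'.marked_closed_med H'.critical_orbit_marked by blast
qed

end

theorem corollary4p20:
  fixes T :: "'a::t2_space set" and f :: "'a \<Rightarrow> 'a" and c :: 'a
    and T' :: "'b::t2_space set" and f' :: "'b \<Rightarrow> 'b" and c' :: 'b
    and \<nu> :: "nat \<Rightarrow> symbol"
  assumes "hubbard_tree T f c" and "hubbard_tree T' f' c'"
    and "star_periodic \<nu> \<or> preperiodic_seq \<nu>"
    and "kneading_sequence T f c = \<nu>" and "kneading_sequence T' f' c' = \<nu>"
  shows "hubbard_equivalent T f c T' f' c'"
proof -
  interpret HP: hubbard_pair T f c T' f' c'
    using assms by unfold_locales simp_all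
  \<comment> \<open>Exchanging the two trees gives surjectivity of the matching.\<close>
  interpret HQ: hubbard_pair T' f' c' T f c
    using assms by unfold_locales simp_all
  have flip: "HQ.matched x' x \<longleftrightarrow> HP.matched x x'" for x x'
    unfolding HP.matched_def HQ.matched_def by auto
  let ?M = "marked_points T f c" and ?M' = "marked_points T' f' c'"
  have uniq: "x' = y'" if "HP.matched x x'" "HP.matched x y'" "x' \<in> ?M'" "y' \<in> ?M'" for x x' y'
    using that HP.H'.itin_inj_on_marked[of x' y'] by (simp add: HP.matched_def)
  have uniq': "x = y" if "HP.matched x x'" "HP.matched y x'" "x \<in> ?M" "y \<in> ?M" for x y x'
    using that HP.H.itin_inj_on_marked[of x y] by (simp add: HP.matched_def)
  obtain \<phi> where \<phi>: "\<And>x. x \<in> ?M \<Longrightarrow> \<phi> x \<in> ?M' \<and> HP.matched x (\<phi> x)"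
    using HP.marked_matched_exists by metis
  have inj: "inj_on \<phi> ?M"
  proof (rule inj_onI)
    fix x y assume "x \<in> ?M" "y \<in> ?M" "\<phi> x = \<phi> y"
    then show "x = y" using uniq'[of x "\<phi> x" y] \<phi>[of x] \<phi>[of y] by simp
  qed
  have img: "\<phi> ` ?M = ?M'"
  proof
    show "\<phi> ` ?M \<subseteq> ?M'" using \<phi> by auto
    show "?M' \<subseteq> \<phi> ` ?M"
    proof
      fix x' assume x': "x' \<in> ?M'"
      then obtain x where x: "x \<in> ?M" "HP.matched x x'" using HQ.marked_matched_exists flip by blast
      then have "\<phi> x = x'" using uniq \<phi> x' by blast
      then show "x' \<in> \<phi> ` ?M" using x(1) by auto
    qed
  qed
  have dyn: "\<phi> (f x) = f' (\<phi> x)" if x: "x \<in> ?M" for x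
  proof (rule uniq)
    show "HP.matched (f x) (\<phi> (f x))" "\<phi> (f x) \<in> ?M'" using \<phi> HP.H.f_marked[OF x] by auto
    show "HP.matched (f x) (f' (\<phi> x))" using HP.matched_f \<phi>[OF x] by simp
    show "f' (\<phi> x) \<in> ?M'" using HP.H'.f_marked \<phi>[OF x] by simp
  qed
  have between: "z \<in> tree_arc T x y \<longleftrightarrow> \<phi> z \<in> tree_arc T' (\<phi> x) (\<phi> y)"
    if M: "x \<in> ?M" "y \<in> ?M" "z \<in> ?M" for x y z
  proof -
    let ?m = "HP.H.med x y z" and ?m' = "HP.H'.med (\<phi> x) (\<phi> y) (\<phi> z)"
    have M': "\<phi> x \<in> ?M'" "\<phi> y \<in> ?M'" "\<phi> z \<in> ?M'" using \<phi> M by auto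
    have m: "?m \<in> ?M" "?m' \<in> ?M'" using HP.H.marked_closed_med[OF M] HP.H'.marked_closed_med[OF M'] .
    have mm: "HP.matched ?m ?m'" using HP.matched_med \<phi> M by simp
    \<comment> \<open>The image of the median and the median of the images are both marked and
      matched with \<open>?m\<close>.\<close>
    have "\<phi> ?m = ?m'" using uniq[OF _ mm] \<phi>[OF m(1)] m(2) by simp
    then have "?m = z \<longleftrightarrow> ?m' = \<phi> z" using inj_onD[OF inj _ m(1) M(3)] by auto
    then show ?thesis
      using HP.H.in_seg_iff_med[OF HP.H.marked_in_T[OF M(1)] HP.H.marked_in_T[OF M(2)] HP.H.marked_in_T[OF M(3)]]
        HP.H'.in_seg_iff_med[OF HP.H'.marked_in_T[OF M'(1)] HP.H'.marked_in_T[OF M'(2)] HP.H'.marked_in_T[OF M'(3)]]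
      by simp
  qed
  have edge: "joined_by_edge T f c x y \<longleftrightarrow> joined_by_edge T' f' c' (\<phi> x) (\<phi> y)"
    if M: "x \<in> ?M" "y \<in> ?M" for x y
  proof -
    \<comment> \<open>The marked points on an arc correspond, and injectivity of
      \<open>\<phi>\<close> then transfers the condition that only the two ends are marked.\<close>
    have "\<phi> ` (tree_arc T x y \<inter> ?M) = tree_arc T' (\<phi> x) (\<phi> y) \<inter> ?M'"
    proof (intro equalityI subsetI)
      fix p assume "p \<in> tree_arc T' (\<phi> x) (\<phi> y) \<inter> ?M'"
      moreover from this obtain z where "z \<in> ?M" "p = \<phi> z" using img by blast
      ultimately show "p \<in> \<phi> ` (tree_arc T x y \<inter> ?M)" using between[OF M] by auto
    next
      fix p assume "p \<in> \<phi> ` (tree_arc T x y \<inter> ?M)"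
      then show "p \<in> tree_arc T' (\<phi> x) (\<phi> y) \<inter> ?M'" using between[OF M] \<phi> by auto
    qed
    moreover have "\<phi> ` {x, y} = {\<phi> x, \<phi> y}" by simp
    moreover have "tree_arc T x y \<inter> ?M = {x, y} \<longleftrightarrow> \<phi> ` (tree_arc T x y \<inter> ?M) = \<phi> ` {x, y}"
      using inj_on_image_eq_iff[OF inj, of "tree_arc T x y \<inter> ?M" "{x, y}"] M by auto
    moreover have "x = y \<longleftrightarrow> \<phi> x = \<phi> y" using inj_on_eq_iff[OF inj M] by simp
    ultimately show ?thesis unfolding joined_by_edge_def by simp
  qed
  show ?thesis
    unfolding hubbard_equivalent_def bij_betw_def using inj img dyn edge by blast
qed

end
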